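(* Let $t$ and $\tilde t$ be any two quasi-homogeneous holomorphic curves of rank $n$ with atoms $\{t_i:0\le i\le n-1\}$ and $\{\tilde t_i:0\le i\le n-1\}$, respectively. Then: (1) If $t$ and $\tilde t$ are unitarily equivalent, then (a) $\mathcal K_{t_i}=\mathcal K_{\tilde t_i}$ for $0\le i\le n-1$; (b) $\theta_{i,i+1}=\tilde\theta_{i,i+1}$ for $0\le i\le n-2$. (2) Suppose that $t$ and $\tilde t$ are unitarily equivalent. If the second fundamental forms are the same, that is, $\theta_{i,i+1}=\tilde\theta_{i,i+1}$ for $0\le i\le n-2$, then $t=\tilde t$.
   Context: $\mathbb D$ is the open unit disc. For $\lambda>0$, $\mathbb A^{(\lambda)}(\mathbb D)$ is the Hilbert space of holomorphic functions on $\mathbb D$ with reproducing kernel $(1-z\bar w)^{-\lambda}$. $B_n(\mathbb D)$ is the Cowen–Douglas class: bounded operators $T$ on a separable Hilbert space such that for each $w\in\mathbb D$, $T-w$ is surjective and $\dim\ker(T-w)=n$, and the subspaces $\ker(T-w)$ span a dense subspace. A quasi-homogeneous holomorphic curve $t$ of rank $n\ge2$ is given by: $\lambda_0>0$, a valency $\Lambda(t)>0$, $\lambda_i=\lambda_0+i\Lambda(t)$, and complex constants $\mu_{i,j}$ ($0\le i\le j\le n-1$) with $\mu_{i,i}=1$ and $\mu_{i,i+1}\ne0$. Put $\mathcal H_i=\mathbb A^{(\lambda_i)}(\mathbb D)$, $\mathcal H=\mathcal H_0\oplus\cdots\oplus\mathcal H_{n-1}$, atoms $t_i(w)(z)=(1-zw)^{-\lambda_i}\in\mathcal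 H_i$, frame $\gamma_j(w)=\sum_{i=0}^j\mu_{i,j}t_i^{(j-i)}(w)$ (derivatives in $w$), and $t(w)=\mathrm{span}\{\gamma_0(w),\dots,\gamma_{n-1}(w)\}$. Standing assumption: the linear transformation $T$ with $T\gamma_j(w)=w\gamma_j(w)$ extends to a bounded operator on $\mathcal H$ belonging to $B_n(\mathbb D)$. Two such curves $t$, $\tilde t$ in $\mathcal H$, $\tilde{\mathcal H}$ are unitarily equivalent (congruent) if there is a unitary $U:\mathcal H\to\tilde{\mathcal H}$ with $U\,t(w)=\tilde t(w)$ for all $w\in\mathbb D$. The curvature of the line bundle spanned by $t_i$ is $\mathcal K_{t_i}(w)=-\partial\bar\partial\log\|t_i(w)\|^2$. The second fundamental form $\theta_{i,i+1}$ of the inclusion of the line bundle spanned by $t_i$ in the rank-two bundle with frame $\{t_i,\ \mu_{i,i+1}t_i^{(1)}+t_{i+1}\}$ is given by $$\theta_{i,i+1}=\frac{\mu_{i,i+1}\,\mathcal K_{t_i}\,d\bar w}{\Big(\frac{\|t_{i+1}\|^2}{\|t_i\|^2}-|\mu_{i,i+1}|^2\,\mathcal K_{t_i}\Big)^{1/2}},$$ and $\tilde\theta_{i,i+1}$ is defined in the same way from $\tilde t$ (with constants $\tilde\mu_{i,j}$).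
   Formalization: In (1)(b) the equality is stated as θ_{i,i+1} = c_i·θ̃_{i,i+1} on the disc for a constant c_i with |c_i|=1: a diagonal unitary can change the phase of μ_{i,i+1}, hence of θ_{i,i+1}, so literal equality of the given coefficients fails. Part (2) assumes literal equality. *)

theory Defs
  imports "HOL-Analysis.Analysis" "HOL-Library.Function_Algebras"
begin

section \<open>Hilbert spaces of complex-valued functions\<close>

text \<open>
  All vectors are functions into the complex numbers with pointwise operations, so that the same notions apply to
  spaces of functions on the disc and to their finite orthogonal direct sums.
\<close>

definition cscale :: "complex \<Rightarrow> ('x \<Rightarrow> complex) \<Rightarrow> ('x \<Rightarrow> complex)" where
  "cscale c f = (\<lambda>x. c * f x)"

interpretation cfun: vector_space cscale
  by unfold_locales (auto simp: cscale_def fun_eq_iff algebra_simps)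

record 'x fspace =
  vecs :: "('x \<Rightarrow> complex) set"
  ip :: "('x \<Rightarrow> complex) \<Rightarrow> ('x \<Rightarrow> complex) \<Rightarrow> complex"

definition hnorm :: "'x fspace \<Rightarrow> ('x \<Rightarrow> complex) \<Rightarrow> real" where
  "hnorm H f = sqrt (Re (ip H f f))"

text \<open>
  The inner product is unconstrained off the carrier, whereas \<^locale>\<open>Metric_space\<close> asks for a
  symmetric nonnegative function on the whole type; hence the case distinction.
\<close>

definition hdist :: "'x fspace \<Rightarrow> ('x \<Rightarrow> complex) \<Rightarrow> ('x \<Rightarrow> complex) \<Rightarrow> real" where
  "hdist H f g = (if f \<in> vecs H \<and> g \<in> vecs H then hnorm H (f - g) else 0)"

abbreviation htopology :: "'x fspace \<Rightarrow> ('x \<Rightarrow> complex) topology" where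
  "htopology H \<equiv> Metric_space.mtopology (vecs H) (hdist H)"

definition hilbert :: "'x fspace \<Rightarrow> bool" where
  "hilbert H \<longleftrightarrow>
     cfun.subspace (vecs H) \<and>
     (\<forall>f\<in>vecs H. \<forall>g\<in>vecs H. \<forall>h\<in>vecs H. ip H (f + g) h = ip H f h + ip H g h) \<and>
     (\<forall>c. \<forall>f\<in>vecs H. \<forall>g\<in>vecs H. ip H (cscale c f) g = c * ip H f g) \<and>
     (\<forall>f\<in>vecs H. \<forall>g\<in>vecs H. ip H g f = cnj (ip H f g)) \<and>
     (\<forall>f\<in>vecs H. f \<noteq> 0 \<longrightarrow> 0 < Re (ip H f f)) \<and>
     Metric_space.mcomplete (vecs H) (hdist H)"

definition linear_between :: "'x fspace \<Rightarrow> 'y fspace \<Rightarrow> (('x \<Rightarrow> complex) \<Rightarrow> ('y \<Rightarrow> complex)) \<Rightarrow> bool" where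
  "linear_between H K T \<longleftrightarrow>
     T \<in> vecs H \<rightarrow> vecs K \<and>
     (\<forall>f\<in>vecs H. \<forall>g\<in>vecs H. T (f + g) = T f + T g) \<and>
     (\<forall>c. \<forall>f\<in>vecs H. T (cscale c f) = cscale c (T f))"

definition bounded_operator :: "'x fspace \<Rightarrow> (('x \<Rightarrow> complex) \<Rightarrow> ('x \<Rightarrow> complex)) \<Rightarrow> bool" where
  "bounded_operator H T \<longleftrightarrow>
     linear_between H H T \<and> (\<exists>B. \<forall>f\<in>vecs H. hnorm H (T f) \<le> B * hnorm H f)"

definition unitary_between :: "'x fspace \<Rightarrow> 'y fspace \<Rightarrow> (('x \<Rightarrow> complex) \<Rightarrow> ('y \<Rightarrow> complex)) \<Rightarrow> bool" where
  "unitary_between H K U \<longleftrightarrow>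
     linear_between H K U \<and> bij_betw U (vecs H) (vecs K) \<and>
     (\<forall>f\<in>vecs H. \<forall>g\<in>vecs H. ip K (U f) (U g) = ip H f g)"

definition direct_sum :: "nat \<Rightarrow> (nat \<Rightarrow> 'x fspace) \<Rightarrow> (nat \<times> 'x) fspace" where
  "direct_sum n X =
     \<lparr>vecs = {h. (\<forall>i<n. (\<lambda>z. h (i, z)) \<in> vecs (X i)) \<and> (\<forall>i\<ge>n. \<forall>z. h (i, z) = 0)},
      ip = (\<lambda>f g. \<Sum>i<n. ip (X i) (\<lambda>z. f (i, z)) (\<lambda>z. g (i, z)))\<rparr>"

text \<open>Here \<open>0 < n\<close> also rules out the convention that infinite-dimensional spaces have
  \<open>cfun.dim\<close> equal to 0.\<close>

definition cowen_douglas ::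
    "nat \<Rightarrow> complex set \<Rightarrow> 'x fspace \<Rightarrow> (('x \<Rightarrow> complex) \<Rightarrow> ('x \<Rightarrow> complex)) \<Rightarrow> bool" where
  "cowen_douglas n \<Omega> H T \<longleftrightarrow>
     0 < n \<and> hilbert H \<and> separable_space (htopology H) \<and> bounded_operator H T \<and>
     (\<forall>w\<in>\<Omega>. (\<lambda>f. T f - cscale w f) ` vecs H = vecs H) \<and>
     (\<forall>w\<in>\<Omega>. cfun.dim {f \<in> vecs H. T f = cscale w f} = n) \<and>
     htopology H closure_of cfun.span (\<Union>w\<in>\<Omega>. {f \<in> vecs H. T f = cscale w f}) = vecs H"

section \<open>The spaces with kernel \<open>(1 - z w\<^sup>*)\<^sup>-\<^sup>\<lambda>\<close>\<close>

abbreviation unit_disc :: "complex set" ("\<D>") where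
  "\<D> \<equiv> ball 0 1"

text \<open>
  Functions on the disc are extended by 0. The power is the principal one; the base has positive
  real part.
\<close>

definition atom :: "real \<Rightarrow> complex \<Rightarrow> complex \<Rightarrow> complex" where
  "atom l w z = (if z \<in> \<D> then (1 - z * w) powr (- complex_of_real l) else 0)"

text \<open>
  The predicate says that \<open>H\<close> is the Hilbert space of holomorphic functions on the disc with
  reproducing kernel \<open>(1 - z w\<^sup>*)\<^sup>-\<^sup>\<lambda>\<close>. By Moore--Aronszajn, carrier and inner product on the carrier
  are determined by the kernel.
\<close>

definition bergman_space :: "real \<Rightarrow> complex fspace \<Rightarrow> bool" where
  "bergman_space l H \<longleftrightarrow>
     hilbert H \<and>
     (\<forall>f\<in>vecs H. f holomorphic_on \<D> \<and> (\<forall>z. z \<notin> \<D> \<longrightarrow> f z = 0)) \<and>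
     (\<forall>w\<in>\<D>. atom l (cnj w) \<in> vecs H \<and> (\<forall>f\<in>vecs H. ip H f (atom l (cnj w)) = f w))"

section \<open>Quasi-homogeneous holomorphic curves\<close>

record qh_data =
  lam0 :: real
  valency :: real
  mu :: "nat \<Rightarrow> nat \<Rightarrow> complex"
  summand :: "nat \<Rightarrow> complex fspace"

definition lam :: "qh_data \<Rightarrow> nat \<Rightarrow> real" where
  "lam C i = lam0 C + real i * valency C"

definition qh_atom :: "qh_data \<Rightarrow> nat \<Rightarrow> complex \<Rightarrow> complex \<Rightarrow> complex" where
  "qh_atom C i = atom (lam C i)"

definition frame :: "nat \<Rightarrow> qh_data \<Rightarrow> nat \<Rightarrow> complex \<Rightarrow> (nat \<times> complex \<Rightarrow> complex)" where
  "frame n C j w = (\<lambda>(i, z). if i \<le> j \<and> j < n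
     then mu C i j * (deriv ^^ (j - i)) (\<lambda>v. qh_atom C i v z) w else 0)"

definition qh_space :: "nat \<Rightarrow> qh_data \<Rightarrow> (nat \<times> complex) fspace" where
  "qh_space n C = direct_sum n (summand C)"

definition curve :: "nat \<Rightarrow> qh_data \<Rightarrow> complex \<Rightarrow> (nat \<times> complex \<Rightarrow> complex) set" where
  "curve n C w = cfun.span ((\<lambda>j. frame n C j w) ` {..<n})"

definition quasi_homogeneous :: "nat \<Rightarrow> qh_data \<Rightarrow> bool" where
  "quasi_homogeneous n C \<longleftrightarrow>
     2 \<le> n \<and> 0 < lam0 C \<and> 0 < valency C \<and>
     (\<forall>i<n. bergman_space (lam C i) (summand C i)) \<and>
     (\<forall>i<n. mu C i i = 1) \<and> (\<forall>i. Suc i < n \<longrightarrow> mu C i (Suc i) \<noteq> 0) \<and>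
     (\<exists>T. cowen_douglas n \<D> (qh_space n C) T \<and>
          (\<forall>w\<in>\<D>. \<forall>j<n. T (frame n C j w) = cscale w (frame n C j w)))"

definition unitarily_equivalent :: "nat \<Rightarrow> qh_data \<Rightarrow> qh_data \<Rightarrow> bool" where
  "unitarily_equivalent n C C' \<longleftrightarrow>
     (\<exists>U. unitary_between (qh_space n C) (qh_space n C') U \<and>
          (\<forall>w\<in>\<D>. U ` curve n C w = curve n C' w))"

section \<open>Curvature and second fundamental form\<close>

definition wirtinger_d :: "(complex \<Rightarrow> complex) \<Rightarrow> complex \<Rightarrow> complex" where
  "wirtinger_d f w = (frechet_derivative f (at w) 1 - \<i> * frechet_derivative f (at w) \<i>) / 2"

definition wirtinger_dbar :: "(complex \<Rightarrow> complex) \<Rightarrow> complex \<Rightarrow> complex" where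
  "wirtinger_dbar f w = (frechet_derivative f (at w) 1 + \<i> * frechet_derivative f (at w) \<i>) / 2"

definition curvature :: "'x fspace \<Rightarrow> (complex \<Rightarrow> 'x \<Rightarrow> complex) \<Rightarrow> complex \<Rightarrow> complex" where
  "curvature H s w =
     - wirtinger_d (wirtinger_dbar (\<lambda>v. complex_of_real (ln ((hnorm H (s v))\<^sup>2)))) w"

definition qh_curvature :: "qh_data \<Rightarrow> nat \<Rightarrow> complex \<Rightarrow> complex" where
  "qh_curvature C i = curvature (summand C i) (qh_atom C i)"

text \<open>
  Coefficient of \<open>dw\<^sup>*\<close> in the second fundamental form of the inclusion of the line bundle spanned
  by the \<open>i\<close>-th atom. It is taken relative to unit frames of the line bundle and of the quotient,
  so rotating these frames by constant phases multiplies it by a constant of modulus 1. The radicand is a positive real.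
\<close>

definition second_fundamental_form :: "qh_data \<Rightarrow> nat \<Rightarrow> complex \<Rightarrow> complex" where
  "second_fundamental_form C i w =
     mu C i (Suc i) * qh_curvature C i w /
     csqrt (complex_of_real ((hnorm (summand C (Suc i)) (qh_atom C (Suc i) w))\<^sup>2 /
                             (hnorm (summand C i) (qh_atom C i w))\<^sup>2)
            - complex_of_real ((cmod (mu C i (Suc i)))\<^sup>2) * qh_curvature C i w)"

end

theory Submission
  imports Defs "HOL-Complex_Analysis.Conformal_Mappings"
begin

text \<open>
  A unitary \<open>U\<close> between two quasi-homogeneous curves is diagonal: it multiplies each component by a constant of
  modulus 1. Both parts of the theorem follow from this.

  Diagonality is proved component by component (\<open>diagonal_step\<close>). Suppose that \<open>U\<close> acts by scalars on the
  components below \<open>k\<close>. By orthogonality it maps the \<open>k\<close>-th atom \<open>t\<^sub>k (w)\<close> into the components from \<open>k\<close> on, and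
  the image agrees there with \<open>U \<gamma>\<^sub>k (w)\<close>, a vector of the second curve. The frame of that curve is triangular,
  so the highest nonzero component of the image, say with index \<open>m\<close>, is \<open>a(w) t\<^sub>m' (w)\<close> with a holomorphic
  function \<open>a\<close>. Since the atoms have norm \<open>(1 - |w|\<^sup>2)\<^sup>-\<^sup>\<lambda>\<^sup>/\<^sup>2\<close>, the function \<open>a\<close> tends to 0 at the boundary if the
  weight \<open>\<lambda>\<^sub>m'\<close> exceeds \<open>\<lambda>\<^sub>k\<close>, and then vanishes by the maximum principle. The weights increase with the index, so
  if \<open>\<lambda>\<^sub>k \<le> \<lambda>\<^sub>k'\<close> then \<open>m = k\<close>, and the reproducing kernels force \<open>a\<close> to be constant and the weights to be equal.
  If \<open>\<lambda>\<^sub>k > \<lambda>\<^sub>k'\<close>, the same argument applies to the inverse of \<open>U\<close>.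

  Equal weights mean equal atoms and, as \<open>curvature_atom\<close> computes the curvature to be \<open>-\<lambda> / (1 - |w|\<^sup>2)\<^sup>2\<close>, equal
  curvatures. If \<open>u\<^sub>i\<close> denotes the scalar on component \<open>i\<close>, the relation between \<open>U \<gamma>\<^sub>i\<^sub>+\<^sub>1\<close> and the second frame
  gives \<open>u\<^sub>i \<mu>\<^sub>i\<^sub>,\<^sub>i\<^sub>+\<^sub>1 = u\<^sub>i\<^sub>+\<^sub>1 \<mu>\<^sub>i\<^sub>,\<^sub>i\<^sub>+\<^sub>1'\<close> (\<open>superdiagonal\<close>). Hence these constants have equal moduli, which yields
  the claim about second fundamental forms. If the forms coincide, then so do the constants, all \<open>u\<^sub>i\<close> are equal,
  and \<open>U\<close> is a scalar; so the two curves are equal.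

  Applying \<open>U\<close> to frame vectors presupposes that derivatives of atoms belong to the Hilbert spaces. This follows
  from Cauchy's inequality and the Riesz representation theorem (\<open>atom_derivative_in_bergman\<close>).
\<close>

section \<open>Hilbert spaces of functions and the Riesz representation theorem\<close>

context
  fixes H :: "'x fspace"
  assumes H: "hilbert H"
begin

lemma hilbert_subspace: "cfun.subspace (vecs H)"
  using H unfolding hilbert_def by blast

lemma vecs_zero: "0 \<in> vecs H"
  and vecs_add: "f \<in> vecs H \<Longrightarrow> g \<in> vecs H \<Longrightarrow> f + g \<in> vecs H"
  and vecs_diff: "f \<in> vecs H \<Longrightarrow> g \<in> vecs H \<Longrightarrow> f - g \<in> vecs H"
  and vecs_scale: "f \<in> vecs H \<Longrightarrow> cscale c f \<in> vecs H"
  using hilbert_subspace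
  by (auto intro: cfun.subspace_0 cfun.subspace_add cfun.subspace_diff cfun.subspace_scale)

lemma ip_add_left:
  "f \<in> vecs H \<Longrightarrow> g \<in> vecs H \<Longrightarrow> h \<in> vecs H \<Longrightarrow> ip H (f + g) h = ip H f h + ip H g h"
  and ip_scale_left: "f \<in> vecs H \<Longrightarrow> g \<in> vecs H \<Longrightarrow> ip H (cscale c f) g = c * ip H f g"
  and ip_commute: "f \<in> vecs H \<Longrightarrow> g \<in> vecs H \<Longrightarrow> ip H g f = cnj (ip H f g)"
  and ip_self_pos: "f \<in> vecs H \<Longrightarrow> f \<noteq> 0 \<Longrightarrow> 0 < Re (ip H f f)"
  using H unfolding hilbert_def by blast+

lemma ip_zero_left: "f \<in> vecs H \<Longrightarrow> ip H 0 f = 0"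
  using ip_add_left[of 0 0 f] vecs_zero by simp

lemma ip_zero_right: "f \<in> vecs H \<Longrightarrow> ip H f 0 = 0"
  using ip_commute[OF vecs_zero] ip_zero_left by simp

lemma ip_diff_left:
  assumes "f \<in> vecs H" "g \<in> vecs H" "h \<in> vecs H"
  shows "ip H (f - g) h = ip H f h - ip H g h"
  using ip_add_left[of "f - g" g h] vecs_diff assms by simp

lemma ip_add_right:
  assumes "f \<in> vecs H" "g \<in> vecs H" "h \<in> vecs H"
  shows "ip H f (g + h) = ip H f g + ip H f h"
  using assms ip_add_left[of g h f] vecs_add[of g h]
    ip_commute[of f g] ip_commute[of f h] ip_commute[of f "g + h"] by (metis complex_cnj_add complex_cnj_cnj)

lemma ip_diff_right:
  assumes "f \<in> vecs H" "g \<in> vecs H" "h \<in> vecs H"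
  shows "ip H f (g - h) = ip H f g - ip H f h"
  using ip_add_right[of f "g - h" h] vecs_diff[of g h] assms by simp

lemma ip_scale_right:
  assumes "f \<in> vecs H" "g \<in> vecs H"
  shows "ip H f (cscale c g) = cnj c * ip H f g"
  using assms ip_scale_left[of g f c] vecs_scale[of g c]
    ip_commute[of f g] ip_commute[of f "cscale c g"] by (metis complex_cnj_mult complex_cnj_cnj)

lemma Re_ip_self_nonneg: "f \<in> vecs H \<Longrightarrow> 0 \<le> Re (ip H f f)"
  using ip_self_pos[of f] ip_zero_left[OF vecs_zero] by (cases "f = 0") auto

lemma ip_self: "f \<in> vecs H \<Longrightarrow> ip H f f = of_real ((hnorm H f)\<^sup>2)"
  using ip_commute[of f f] Re_ip_self_nonneg[of f]
  by (auto simp: hnorm_def complex_eq_iff)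

lemma hnorm_nonneg: "f \<in> vecs H \<Longrightarrow> 0 \<le> hnorm H f"
  by (simp add: hnorm_def Re_ip_self_nonneg)

lemma hnorm_eq_zero: "f \<in> vecs H \<Longrightarrow> hnorm H f = 0 \<longleftrightarrow> f = 0"
  using ip_self_pos[of f] ip_zero_left[OF vecs_zero] by (cases "f = 0") (auto simp: hnorm_def)

lemma hnorm_scale: "f \<in> vecs H \<Longrightarrow> hnorm H (cscale c f) = cmod c * hnorm H f"
proof -
  assume f: "f \<in> vecs H"
  have "complex_of_real ((hnorm H (cscale c f))\<^sup>2) = c * cnj c * ip H f f"
    using f vecs_scale[OF f, of c]
    by (simp only: ip_self[symmetric] ip_scale_left ip_scale_right mult.assoc mult.left_commute)
  also have "\<dots> = of_real ((cmod c)\<^sup>2) * of_real ((hnorm H f)\<^sup>2)"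
    by (simp only: ip_self[OF f] complex_norm_square)
  finally have "complex_of_real ((hnorm H (cscale c f))\<^sup>2) = of_real ((cmod c * hnorm H f)\<^sup>2)"
    by (simp add: power_mult_distrib)
  then show ?thesis
    using hnorm_nonneg[OF f] hnorm_nonneg[OF vecs_scale[OF f, of c]]
    by (metis mult_nonneg_nonneg norm_ge_zero of_real_eq_iff power2_eq_iff_nonneg)
qed

lemma hnorm_diff_square:
  assumes "f \<in> vecs H" "g \<in> vecs H"
  shows "(hnorm H (f - g))\<^sup>2 = (hnorm H f)\<^sup>2 - 2 * Re (ip H f g) + (hnorm H g)\<^sup>2"
proof -
  have "ip H (f - g) (f - g) = ip H f f - ip H f g - cnj (ip H f g) + ip H g g"
    using assms vecs_diff[of f g] ip_commute[of f g]
    by (simp add: ip_diff_left ip_diff_right)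
  then show ?thesis
    using assms vecs_diff[of f g] by (simp add: ip_self complex_eq_iff)
qed

lemma hnorm_add_square:
  assumes "f \<in> vecs H" "g \<in> vecs H"
  shows "(hnorm H (f + g))\<^sup>2 = (hnorm H f)\<^sup>2 + 2 * Re (ip H f g) + (hnorm H g)\<^sup>2"
proof -
  have "ip H (f + g) (f + g) = ip H f f + ip H f g + cnj (ip H f g) + ip H g g"
    using assms vecs_add[of f g] ip_commute[of f g]
    by (simp add: ip_add_left ip_add_right)
  then show ?thesis
    using assms vecs_add[of f g] by (simp add: ip_self complex_eq_iff)
qed

lemma Cauchy_Schwarz_ip:
  assumes f: "f \<in> vecs H" and g: "g \<in> vecs H"
  shows "cmod (ip H f g) \<le> hnorm H f * hnorm H g"
proof (cases "g = 0")
  case True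
  then show ?thesis using f ip_zero_right hnorm_eq_zero[OF g] by simp
next
  case False
  define a where "a = ip H f g"
  define N where "N = (hnorm H g)\<^sup>2"
  have N: "N > 0"
    using False g hnorm_eq_zero[OF g] by (simp add: N_def)
  have "0 \<le> (hnorm H (f - cscale (a / N) g))\<^sup>2" by simp
  also have "\<dots> = (hnorm H f)\<^sup>2 - 2 * Re (cnj (a / N) * a) + (cmod (a / N) * hnorm H g)\<^sup>2"
    using f g vecs_scale[OF g] by (simp add: hnorm_diff_square ip_scale_right hnorm_scale a_def)
  also have "Re (cnj (a / N) * a) = (cmod a)\<^sup>2 / N"
    by (simp add: cmod_power2) (simp add: power2_eq_square add_divide_distrib)
  also have "(cmod (a / N) * hnorm H g)\<^sup>2 = (cmod a)\<^sup>2 / N"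
    using N by (simp add: power_mult_distrib norm_divide power_divide flip: N_def)
       (simp add: power2_eq_square)
  finally have "(cmod a)\<^sup>2 / N \<le> (hnorm H f)\<^sup>2" by simp
  then have "(cmod a)\<^sup>2 \<le> (hnorm H f * hnorm H g)\<^sup>2"
    using N by (simp add: power_mult_distrib N_def field_simps)
  then show ?thesis
    unfolding a_def using hnorm_nonneg f g by (simp add: power2_le_iff_abs_le)
qed

lemma hnorm_triangle:
  assumes "f \<in> vecs H" "g \<in> vecs H"
  shows "hnorm H (f + g) \<le> hnorm H f + hnorm H g"
proof -
  have "Re (ip H f g) \<le> hnorm H f * hnorm H g"
    using complex_Re_le_cmod Cauchy_Schwarz_ip[OF assms] by (rule order_trans)
  then have "(hnorm H (f + g))\<^sup>2 \<le> (hnorm H f + hnorm H g)\<^sup>2"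
    using assms by (simp add: hnorm_add_square power2_sum)
  then show ?thesis
    by (rule power2_le_imp_le) (simp add: hnorm_nonneg assms)
qed

lemma hnorm_minus_commute: "f \<in> vecs H \<Longrightarrow> g \<in> vecs H \<Longrightarrow> hnorm H (f - g) = hnorm H (g - f)"
proof -
  assume "f \<in> vecs H" "g \<in> vecs H"
  moreover have "hnorm H (f - g) = hnorm H (cscale (-1) (g - f))"
    by (rule arg_cong[where f = "hnorm H"]) (auto simp: cscale_def)
  ultimately show ?thesis using hnorm_scale[of "g - f" "-1"] vecs_diff[of g f] by (metis mult_1 norm_minus_cancel norm_one)
qed

lemma Metric_space_hdist: "Metric_space (vecs H) (hdist H)"
proof
  fix f g h
  show "0 \<le> hdist H f g"
    by (simp add: hdist_def hnorm_nonneg vecs_diff)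
  show "hdist H f g = hdist H g f"
    by (simp add: hdist_def hnorm_minus_commute)
  show "f \<in> vecs H \<Longrightarrow> g \<in> vecs H \<Longrightarrow> (hdist H f g = 0) = (f = g)"
    by (simp add: hdist_def hnorm_eq_zero vecs_diff)
  assume "f \<in> vecs H" "g \<in> vecs H" "h \<in> vecs H"
  then show "hdist H f h \<le> hdist H f g + hdist H g h"
    using hnorm_triangle[of "f - g" "g - h"] by (simp add: hdist_def vecs_diff)
qed

lemma hilbert_complete:
  assumes "\<And>k. s k \<in> vecs H"
    and Cauchy: "\<And>e. e > 0 \<Longrightarrow> \<exists>N. \<forall>k\<ge>N. \<forall>l\<ge>N. hnorm H (s k - s l) < e"
  obtains f where "f \<in> vecs H" "(\<lambda>k. hnorm H (s k - f)) \<longlonglongrightarrow> 0"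
proof -
  interpret M: Metric_space "vecs H" "hdist H" by (rule Metric_space_hdist)
  have "M.MCauchy s"
    unfolding M.MCauchy_def using assms by (simp add: hdist_def image_subset_iff)
  moreover have "M.mcomplete" using H unfolding hilbert_def by blast
  ultimately obtain f where "limitin M.mtopology s f sequentially"
    unfolding M.mcomplete_def by blast
  then have "f \<in> vecs H" "(\<lambda>k. hdist H (s k) f) \<longlonglongrightarrow> 0"
    by (auto simp: M.limitin_metric_dist_null)
  then show ?thesis using that assms(1) by (simp add: hdist_def)
qed

text \<open>
  The quadratic functional \<open>J f = \<parallel>f\<parallel>\<^sup>2 - 2 Re (\<phi> f)\<close> is bounded below, and by the parallelogram law every
  minimising sequence is Cauchy. Its limit represents \<open>\<phi>\<close>: comparing \<open>J\<close> at an almost minimiser \<open>s\<close> with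
  \<open>J\<close> at \<open>s - c f\<close>, for a suitable small \<open>c\<close>, shows that \<open>\<langle>f, s\<rangle>\<close> is close to \<open>\<phi> f\<close>. Minimising \<open>J\<close>
  instead of the norm on the hyperplane \<open>\<phi> = 1\<close> makes \<open>\<phi> = 0\<close> an ordinary case.
\<close>

theorem Riesz_representation:
  assumes add: "\<And>f g. f \<in> vecs H \<Longrightarrow> g \<in> vecs H \<Longrightarrow> \<phi> (f + g) = \<phi> f + \<phi> g"
    and scale: "\<And>c f. f \<in> vecs H \<Longrightarrow> \<phi> (cscale c f) = c * \<phi> f"
    and bound: "\<And>f. f \<in> vecs H \<Longrightarrow> cmod (\<phi> f) \<le> B * hnorm H f"
  obtains g where "g \<in> vecs H" "\<And>f. f \<in> vecs H \<Longrightarrow> \<phi> f = ip H f g"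
proof -
  define J where "J f = (hnorm H f)\<^sup>2 - 2 * Re (\<phi> f)" for f
  define m where "m = Inf (J ` vecs H)"
  have "- B\<^sup>2 \<le> J f" if f: "f \<in> vecs H" for f
  proof -
    have "Re (\<phi> f) \<le> B * hnorm H f"
      using complex_Re_le_cmod bound[OF f] by (rule order_trans)
    moreover have "0 \<le> (hnorm H f - B)\<^sup>2" by simp
    ultimately show ?thesis by (simp add: J_def power2_diff mult.commute)
  qed
  then have bdd: "bdd_below (J ` vecs H)" by (auto intro!: bdd_belowI)
  have m_le: "m \<le> J f" if "f \<in> vecs H" for f
    unfolding m_def using that bdd by (auto intro: cInf_lower)
  have "\<exists>f\<in>vecs H. J f < m + 1 / Suc k" for k :: nat
    using cInf_lessD[of "J ` vecs H" "m + 1 / Suc k"] vecs_zero by (auto simp: m_def)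
  then obtain s where s: "\<And>k. s k \<in> vecs H" and Js: "\<And>k. J (s k) < m + 1 / Suc k"
    by metis
  \<comment> \<open>Parallelogram law, with \<open>J \<ge> m\<close> applied to the midpoint.\<close>
  have par: "(hnorm H (f - g))\<^sup>2 \<le> 2 * (J f - m) + 2 * (J g - m)"
    if f: "f \<in> vecs H" and g: "g \<in> vecs H" for f g
  proof -
    have "J (cscale (1/2) (f + g)) = (hnorm H (f + g))\<^sup>2 / 4 - (Re (\<phi> f) + Re (\<phi> g))"
      using f g by (simp add: J_def hnorm_scale scale add vecs_add power_mult_distrib power_divide
          del: cfun.scale_right_distrib) (simp add: field_simps)
    then have "(hnorm H (f - g))\<^sup>2 = 2 * J f + 2 * J g - 4 * J (cscale (1/2) (f + g))"
      using hnorm_add_square[OF f g] hnorm_diff_square[OF f g] J_def[of f] J_def[of g] by linarith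
    with m_le[of "cscale (1/2) (f + g)"] f g show ?thesis by (simp add: vecs_add vecs_scale)
  qed
  have "\<exists>N. \<forall>k\<ge>N. \<forall>l\<ge>N. hnorm H (s k - s l) < e" if "e > 0" for e
  proof -
    obtain N :: nat where N: "4 / e\<^sup>2 < real N" using reals_Archimedean2 by blast
    have "hnorm H (s k - s l) < e" if "k \<ge> N" "l \<ge> N" for k l
    proof -
      have le: "1 / real (Suc j) \<le> 1 / real (Suc N)" if "j \<ge> N" for j
        using that by (simp add: frac_le)
      have "(hnorm H (s k - s l))\<^sup>2 < 4 * (1 / Suc N)"
        using par[OF s s, of k l] Js[of k] Js[of l] le[OF \<open>k \<ge> N\<close>] le[OF \<open>l \<ge> N\<close>] by argo
      also have "\<dots> < e\<^sup>2"
        using N \<open>e > 0\<close> by (simp add: field_simps) (smt (verit) zero_less_power)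
      finally show ?thesis using \<open>e > 0\<close> by (simp add: power2_less_imp_less)
    qed
    then show ?thesis by blast
  qed
  then obtain g where g: "g \<in> vecs H" and lim: "(\<lambda>k. hnorm H (s k - g)) \<longlonglongrightarrow> 0"
    using hilbert_complete s by metis
  have "\<phi> f = ip H f g" if f: "f \<in> vecs H" for f
  proof -
    define N where "N = (hnorm H f)\<^sup>2"
    \<comment> \<open>The step size: small enough that in \<open>J (s k - h)\<close> the quadratic term is at most half of the linear one.\<close>
    define t where "t = 1 / (1 + N)"
    have N: "N \<ge> 0" by (simp add: N_def)
    have t: "t > 0" "t * N \<le> 1" using N by (auto simp: t_def field_simps)
    have small: "t * (cmod (ip H f (s k) - \<phi> f))\<^sup>2 \<le> 1 / Suc k" for k
    proof -
      define a where "a = ip H f (s k) - \<phi> f"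
      define h where "h = cscale (t * cnj a) f"
      have h: "h \<in> vecs H" by (simp add: h_def f vecs_scale)
      have "\<phi> (s k) = \<phi> (s k - h) + \<phi> h"
        using add[OF vecs_diff[OF s h] h, of k] by simp
      moreover have "Re (ip H (s k) h) - Re (\<phi> h) = Re (t * cnj a * a)"
      proof -
        have "Re (ip H (s k) h) = Re (ip H h (s k))" using ip_commute[OF s h, of k] by simp
        then have "Re (ip H (s k) h) - Re (\<phi> h) = Re (ip H h (s k) - \<phi> h)" by simp
        also have "ip H h (s k) - \<phi> h = t * cnj a * a"
          using f s by (simp add: h_def ip_scale_left scale a_def right_diff_distrib
              del: cfun.scale_left_diff_distrib complex_cnj_diff)
        finally show ?thesis .
      qed
      moreover have "(hnorm H h)\<^sup>2 = (t * cmod a)\<^sup>2 * N"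
        using f t(1) by (simp add: h_def hnorm_scale norm_mult power_mult_distrib N_def)
      ultimately have "J (s k - h) = J (s k) - 2 * Re (t * cnj a * a) + (t * cmod a)\<^sup>2 * N"
        using hnorm_diff_square[OF s h, of k] by (simp add: J_def)
      also have "Re (t * cnj a * a) = t * (cmod a)\<^sup>2"
        by (simp add: cmod_power2) (simp add: power2_eq_square algebra_simps)
      also have "(t * cmod a)\<^sup>2 * N = t * (cmod a)\<^sup>2 * (t * N)"
        by (simp add: power_mult_distrib power2_eq_square)
      also have "\<dots> \<le> t * (cmod a)\<^sup>2 * 1"
        using t by (intro mult_left_mono) auto
      finally show ?thesis
        unfolding a_def[symmetric] using m_le[OF vecs_diff[OF s h], of k] Js[of k] by linarith
    qed
    have "(\<lambda>k. t * (cmod (ip H f (s k) - \<phi> f))\<^sup>2) \<longlonglongrightarrow> 0"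
      by (rule tendsto_sandwich[OF _ _ tendsto_const LIMSEQ_Suc[OF lim_1_over_n]])
        (use small t in \<open>auto simp: intro!: always_eventually\<close>)
    moreover have "(\<lambda>k. ip H f (s k)) \<longlonglongrightarrow> ip H f g"
    proof -
      have "(\<lambda>k. ip H f g - ip H f (s k)) \<longlonglongrightarrow> 0"
      proof (rule Lim_null_comparison)
        show "\<forall>\<^sub>F k in sequentially. cmod (ip H f g - ip H f (s k)) \<le> hnorm H f * hnorm H (s k - g)"
          using Cauchy_Schwarz_ip[OF f vecs_diff[OF g s]] f g s
          by (auto simp: ip_diff_right hnorm_minus_commute[OF s g])
        show "(\<lambda>k. hnorm H f * hnorm H (s k - g)) \<longlonglongrightarrow> 0"
          using tendsto_mult_right_zero[OF lim] by simp
      qed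
      from tendsto_diff[OF tendsto_const this, of "ip H f g"] show ?thesis by simp
    qed
    then have "(\<lambda>k. t * (cmod (ip H f (s k) - \<phi> f))\<^sup>2) \<longlonglongrightarrow> t * (cmod (ip H f g - \<phi> f))\<^sup>2"
      by (intro tendsto_intros)
    ultimately have "t * (cmod (ip H f g - \<phi> f))\<^sup>2 = 0"
      using LIMSEQ_unique by blast
    then show ?thesis using t by simp
  qed
  with g that show ?thesis by blast
qed

end

lemma unitary_inverse:
  assumes H: "hilbert H" and U: "unitary_between H K U"
  obtains V where "unitary_between K H V"
    and "\<And>f. f \<in> vecs H \<Longrightarrow> V (U f) = f" and "\<And>g. g \<in> vecs K \<Longrightarrow> U (V g) = g"
proof
  let ?V = "inv_into (vecs H) U"
  have bij: "bij_betw U (vecs H) (vecs K)"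
    and add: "\<And>f g. f \<in> vecs H \<Longrightarrow> g \<in> vecs H \<Longrightarrow> U (f + g) = U f + U g"
    and scale: "\<And>c f. f \<in> vecs H \<Longrightarrow> U (cscale c f) = cscale c (U f)"
    and ip: "\<And>f g. f \<in> vecs H \<Longrightarrow> g \<in> vecs H \<Longrightarrow> ip K (U f) (U g) = ip H f g"
    using U unfolding unitary_between_def linear_between_def by blast+
  show VU: "\<And>f. f \<in> vecs H \<Longrightarrow> ?V (U f) = f"
    using bij by (simp add: bij_betw_inv_into_left)
  show UV: "\<And>g. g \<in> vecs K \<Longrightarrow> U (?V g) = g"
    using bij by (simp add: bij_betw_inv_into_right)
  have V: "?V g \<in> vecs H" if "g \<in> vecs K" for g
    using bij_betw_inv_into[OF bij] that by (rule bij_betw_apply)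
  have "?V (f + g) = ?V f + ?V g" if "f \<in> vecs K" "g \<in> vecs K" for f g
    using VU[of "?V f + ?V g"] add[of "?V f" "?V g"] that V UV vecs_add[OF H] by simp
  moreover have "?V (cscale c f) = cscale c (?V f)" if "f \<in> vecs K" for c f
    using VU[of "cscale c (?V f)"] scale[of "?V f" c] that V UV vecs_scale[OF H] by simp
  moreover have "ip H (?V f) (?V g) = ip K f g" if "f \<in> vecs K" "g \<in> vecs K" for f g
    using ip[of "?V f" "?V g"] that V UV by simp
  ultimately show "unitary_between K H ?V"
    unfolding unitary_between_def linear_between_def using V bij_betw_inv_into[OF bij] by blast
qed

section \<open>Atoms, their derivatives and their curvature\<close>

lemma disc_mult_Re_pos:
  fixes z w :: complex
  assumes "z \<in> \<D>" "w \<in> \<D>"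
  shows "0 < Re (1 - z * w)"
proof -
  have "cmod (z * w) < 1"
    using assms mult_strict_mono[of "cmod z" 1 "cmod w" 1] by (simp add: norm_mult)
  then show ?thesis using complex_Re_le_cmod[of "z * w"] by simp
qed

lemma atom_commute: "z \<in> \<D> \<Longrightarrow> w \<in> \<D> \<Longrightarrow> atom l w z = atom l z w"
  by (simp add: atom_def mult.commute)

lemma cnj_atom:
  assumes "z \<in> \<D>" "w \<in> \<D>"
  shows "cnj (atom l w z) = atom l (cnj w) (cnj z)"
  using assms disc_mult_Re_pos[OF assms] by (simp add: atom_def cnj_powr)

lemma atom_zero: "atom l w 0 = 1"
  by (simp add: atom_def)

lemma atom_diagonal:
  assumes "w \<in> \<D>"
  shows "atom l w (cnj w) = of_real ((1 - (cmod w)\<^sup>2) powr (- l))"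
proof -
  have "(cmod w)\<^sup>2 < 1" using assms by (simp add: power_less_one_iff abs_square_less_1)
  moreover have "1 - cnj w * w = of_real (1 - (cmod w)\<^sup>2)"
    by (simp only: complex_norm_square of_real_diff of_real_1 mult.commute)
  ultimately show ?thesis using assms
    using powr_of_real[of "1 - (cmod w)\<^sup>2" "- l"] by (simp add: atom_def)
qed

lemma atom_holomorphic:
  assumes "w \<in> \<D>"
  shows "atom l w holomorphic_on \<D>"
proof (rule holomorphic_transform)
  show "(\<lambda>z. (1 - z * w) powr (- complex_of_real l)) holomorphic_on \<D>"
    using disc_mult_Re_pos[OF _ assms] 
    by (intro holomorphic_intros) (force simp: complex_nonpos_Reals_iff)
qed (simp add: atom_def)

lemma atom_holomorphic_param:
  assumes "z \<in> \<D>"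
  shows "(\<lambda>v. atom l v z) holomorphic_on \<D>"
  using atom_holomorphic[OF assms]
  by (rule holomorphic_transform) (simp add: atom_commute[OF assms])

lemma higher_deriv_cnj_cnj:
  assumes f: "f holomorphic_on \<D>" and w: "w \<in> \<D>"
  shows "(deriv ^^ m) (\<lambda>v. cnj (f (cnj v))) w = cnj ((deriv ^^ m) f (cnj w))"
  using w
proof (induction m arbitrary: w)
  case (Suc m)
  have "((deriv ^^ m) f has_field_derivative (deriv ^^ Suc m) f (cnj w)) (at (cnj w))"
    using holomorphic_derivI[OF holomorphic_higher_deriv[OF f], of "cnj w"] Suc.prems by simp
  then have "((cnj \<circ> (deriv ^^ m) f \<circ> cnj) has_field_derivative cnj ((deriv ^^ Suc m) f (cnj w))) (at w)"
    by (simp only: has_field_derivative_cnj_cnj complex_cnj_cnj)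
  then have "((deriv ^^ m) (\<lambda>v. cnj (f (cnj v))) has_field_derivative cnj ((deriv ^^ Suc m) f (cnj w))) (at w)"
    by (rule has_field_derivative_transform_within_open[where S = \<D>]) (use Suc in auto)
  then show ?case by (simp add: DERIV_imp_deriv)
qed simp

text \<open>
  The maximum principle on the circles \<open>|z| = r\<close>, with \<open>r\<close> tending to 1.
\<close>

lemma holomorphic_eq_zero_if_boundary_decay:
  assumes a: "a holomorphic_on \<D>" and s: "0 < s"
    and bound: "\<And>w. w \<in> \<D> \<Longrightarrow> (cmod (a w))\<^sup>2 \<le> (1 - (cmod w)\<^sup>2) powr s"
    and w: "w \<in> \<D>"
  shows "a w = 0"
proof -
  have le: "(cmod (a w))\<^sup>2 \<le> (1 - r\<^sup>2) powr s" if r: "cmod w < r" "r < 1" for r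
  proof -
    have r0: "0 < r" using r(1) norm_ge_zero[of w] by linarith
    have sub: "cball 0 r \<subseteq> \<D>" using r by auto
    have "cmod (a w) \<le> sqrt ((1 - r\<^sup>2) powr s)"
    proof (rule maximum_modulus_frontier[of a "cball 0 r"])
      show "a holomorphic_on interior (cball 0 r)"
        using a sub by (meson holomorphic_on_subset interior_subset order_trans)
      show "continuous_on (closure (cball 0 r)) a"
        using continuous_on_subset[OF holomorphic_on_imp_continuous_on[OF a] sub] by simp
      show "cmod (a z) \<le> sqrt ((1 - r\<^sup>2) powr s)" if "z \<in> frontier (cball 0 r)" for z
        using that bound[of z] r r0 by (intro real_le_rsqrt) simp
    qed (use r r0 in auto)
    then show ?thesis
      by (metis norm_ge_zero power2_less_imp_less power_mono powr_ge_zero real_sqrt_pow2)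
  qed
  have "\<forall>\<^sub>F r in at_left 1. (cmod (a w))\<^sup>2 \<le> (1 - r\<^sup>2) powr s"
    using w le by (auto intro!: eventually_at_leftI[of "cmod w"])
  moreover have "((\<lambda>r::real. (1 - r\<^sup>2) powr s) \<longlongrightarrow> (1 - 1\<^sup>2) powr s) (at_left 1)"
    using s by (intro tendsto_powr' tendsto_intros)
      (auto intro!: eventually_at_leftI[of 0] simp: power_le_one)
  ultimately have "(cmod (a w))\<^sup>2 \<le> 0"
    using s by (intro tendsto_lowerbound[where F = "at_left (1::real)"]) auto
  then show ?thesis by simp
qed

context
  fixes H :: "complex fspace" and l :: real
  assumes H: "bergman_space l H"
begin

lemma bergman_hilbert: "hilbert H"
  and bergman_holomorphic: "f \<in> vecs H \<Longrightarrow> f holomorphic_on \<D>"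
  and bergman_outside: "f \<in> vecs H \<Longrightarrow> z \<notin> \<D> \<Longrightarrow> f z = 0"
  using H unfolding bergman_space_def by blast+

lemma atom_in_bergman: "w \<in> \<D> \<Longrightarrow> atom l w \<in> vecs H"
  and ip_atom: "w \<in> \<D> \<Longrightarrow> f \<in> vecs H \<Longrightarrow> ip H f (atom l w) = f (cnj w)"
proof -
  have "\<And>w. w \<in> \<D> \<Longrightarrow> atom l (cnj w) \<in> vecs H \<and> (\<forall>f\<in>vecs H. ip H f (atom l (cnj w)) = f w)"
    using H unfolding bergman_space_def by blast
  from this[of "cnj w"] show "w \<in> \<D> \<Longrightarrow> atom l w \<in> vecs H"
    "w \<in> \<D> \<Longrightarrow> f \<in> vecs H \<Longrightarrow> ip H f (atom l w) = f (cnj w)"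
    by simp_all
qed

lemma hnorm_atom: "w \<in> \<D> \<Longrightarrow> (hnorm H (atom l w))\<^sup>2 = (1 - (cmod w)\<^sup>2) powr (- l)"
proof -
  assume w: "w \<in> \<D>"
  have "complex_of_real ((hnorm H (atom l w))\<^sup>2) = of_real ((1 - (cmod w)\<^sup>2) powr (- l))"
    using ip_self[OF bergman_hilbert atom_in_bergman[OF w]] ip_atom[OF w atom_in_bergman[OF w]]
      atom_diagonal[OF w] by simp
  then show ?thesis by (simp only: of_real_eq_iff)
qed

lemma bergman_point_evaluation:
  assumes "f \<in> vecs H" "w \<in> \<D>"
  shows "(cmod (f w))\<^sup>2 \<le> (hnorm H f)\<^sup>2 * (1 - (cmod w)\<^sup>2) powr (- l)"
proof -
  have w: "cnj w \<in> \<D>" using assms by simp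
  have "cmod (f w) \<le> hnorm H f * hnorm H (atom l (cnj w))"
    using Cauchy_Schwarz_ip[OF bergman_hilbert assms(1) atom_in_bergman[OF w]]
      ip_atom[OF w assms(1)] by simp
  then have "(cmod (f w))\<^sup>2 \<le> (hnorm H f * hnorm H (atom l (cnj w)))\<^sup>2"
    by (simp add: power_mono)
  then show ?thesis using hnorm_atom[OF w] by (simp add: power_mult_distrib)
qed

text \<open>
  Derivatives of atoms with respect to the parameter are the vectors that represent the functionals
  \<open>f \<mapsto> f\<^sup>(\<^sup>m\<^sup>) (w\<^sup>*)\<close>, which are bounded by Cauchy's inequality together with the boundedness of point evaluations.
  This is what puts the frame vectors of a quasi-homogeneous curve into the Hilbert space.
\<close>

lemma atom_derivative_in_bergman:
  assumes l: "0 < l" and w: "w \<in> \<D>"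
  shows "(\<lambda>z. (deriv ^^ m) (\<lambda>v. atom l v z) w) \<in> vecs H"
proof -
  define r where "r = (1 - cmod w) / 2"
  define \<rho> where "\<rho> = cmod w + r"
  define K where "K = sqrt ((1 - \<rho>\<^sup>2) powr (- l))"
  have r: "0 < r" "\<rho> < 1" "0 \<le> \<rho>" using w by (auto simp: r_def \<rho>_def field_simps add_nonneg_nonneg)
  have in_disc: "x \<in> \<D> \<and> cmod x \<le> \<rho>" if "cmod (cnj w - x) \<le> r" for x
    using that norm_triangle_ineq2[of x "cnj w"] r by (simp add: \<rho>_def norm_minus_commute)
  have sub: "cball (cnj w) r \<subseteq> \<D>" using in_disc by (auto simp: dist_norm)
  have "cmod ((deriv ^^ m) f (cnj w)) \<le> (fact m * K / r ^ m) * hnorm H f" if f: "f \<in> vecs H" for f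
  proof -
    have hol: "f holomorphic_on \<D>" by (rule bergman_holomorphic[OF f])
    have "cmod ((deriv ^^ m) f (cnj w)) \<le> fact m * (hnorm H f * K) / r ^ m"
    proof (rule Cauchy_inequality)
      show "f holomorphic_on ball (cnj w) r"
        using hol sub ball_subset_cball by (meson holomorphic_on_subset order_trans)
      show "continuous_on (cball (cnj w) r) f"
        using hol sub holomorphic_on_imp_continuous_on continuous_on_subset by blast
      show "cmod (f x) \<le> hnorm H f * K" if "cmod (cnj w - x) = r" for x
      proof (rule power2_le_imp_le)
        have x: "x \<in> \<D>" "cmod x \<le> \<rho>" using in_disc that by auto
        have "(1 - (cmod x)\<^sup>2) powr (- l) \<le> (1 - \<rho>\<^sup>2) powr (- l)"
          using l x r by (intro powr_mono2') (auto simp: power_mono abs_square_less_1)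
        then have "(hnorm H f)\<^sup>2 * (1 - (cmod x)\<^sup>2) powr (- l) \<le> (hnorm H f * K)\<^sup>2"
          by (simp add: K_def power_mult_distrib mult_left_mono)
        then show "(cmod (f x))\<^sup>2 \<le> (hnorm H f * K)\<^sup>2"
          using bergman_point_evaluation[OF f x(1)] by linarith
        show "0 \<le> hnorm H f * K"
          using hnorm_nonneg[OF bergman_hilbert f] by (simp add: K_def)
      qed
    qed (use r in auto)
    then show ?thesis by (simp add: mult_ac)
  qed
  moreover have "(deriv ^^ m) (f + g) (cnj w) = (deriv ^^ m) f (cnj w) + (deriv ^^ m) g (cnj w)"
    if "f \<in> vecs H" "g \<in> vecs H" for f g
    using higher_deriv_add[OF bergman_holomorphic bergman_holomorphic, OF that] w
    by (simp add: plus_fun_def)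
  moreover have "(deriv ^^ m) (cscale c f) (cnj w) = c * (deriv ^^ m) f (cnj w)"
    if "f \<in> vecs H" for c f
    using higher_deriv_cmult[OF bergman_holomorphic[OF that], of "cnj w"] w
    by (simp add: cscale_def)
  ultimately obtain g where g: "g \<in> vecs H"
    and rep: "\<And>f. f \<in> vecs H \<Longrightarrow> (deriv ^^ m) f (cnj w) = ip H f g"
    using Riesz_representation[OF bergman_hilbert, of "\<lambda>f. (deriv ^^ m) f (cnj w)"] by blast
  have "g z = (deriv ^^ m) (\<lambda>v. atom l v z) w" for z
  proof (cases "z \<in> \<D>")
    case True
    then have z: "cnj z \<in> \<D>" by simp
    have "g z = ip H g (atom l (cnj z))" using ip_atom[OF z g] by simp
    also have "\<dots> = cnj (ip H (atom l (cnj z)) g)"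
      by (rule ip_commute[OF bergman_hilbert atom_in_bergman[OF z] g])
    also have "\<dots> = cnj ((deriv ^^ m) (atom l (cnj z)) (cnj w))"
      by (simp add: rep atom_in_bergman[OF z])
    also have "\<dots> = (deriv ^^ m) (\<lambda>v. cnj (atom l (cnj z) (cnj v))) w"
      by (rule higher_deriv_cnj_cnj[OF atom_holomorphic[OF z] w, symmetric])
    also have "\<dots> = (deriv ^^ m) (\<lambda>v. atom l v z) w"
    proof (rule higher_deriv_transform_within_open[where S = \<D>])
      show eq: "cnj (atom l (cnj z) (cnj v)) = atom l v z" if "v \<in> \<D>" for v
        using that z cnj_atom[of "cnj v" "cnj z"] atom_commute[of v z] True by simp
      show hol: "(\<lambda>v. atom l v z) holomorphic_on \<D>" by (rule atom_holomorphic_param[OF True])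
      show "(\<lambda>v. cnj (atom l (cnj z) (cnj v))) holomorphic_on \<D>"
        using hol by (rule holomorphic_transform) (simp only: eq)
    qed (use w in auto)
    finally show ?thesis .
  next
    case False
    then show ?thesis using bergman_outside[OF g] by (simp add: atom_def)
  qed
  then have "(\<lambda>z. (deriv ^^ m) (\<lambda>v. atom l v z) w) = g" by auto
  with g show ?thesis by simp
qed

text \<open>
  By \<open>hnorm_atom\<close> the function under the two derivatives is \<open>-\<lambda> log (1 - |v|\<^sup>2)\<close>, and the first of them turns it
  into \<open>\<lambda> v / (1 - |v|\<^sup>2)\<close>.
\<close>

lemma curvature_atom:
  assumes w: "w \<in> \<D>"
  shows "curvature H (atom l) w = - complex_of_real (l / (1 - (cmod w)\<^sup>2)\<^sup>2)"
proof -
  have disc: "1 - v \<bullet> v > 0" if "v \<in> \<D>" for v :: complex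
    using that by (simp add: power2_norm_eq_inner[symmetric] abs_square_less_1)
  have dbar: "wirtinger_dbar (\<lambda>v. complex_of_real (ln ((hnorm H (atom l v))\<^sup>2))) v
      = of_real (l / (1 - v \<bullet> v)) * v" if v: "v \<in> \<D>" for v
  proof -
    have "((\<lambda>v. complex_of_real (- l * ln (1 - v \<bullet> v))) has_derivative
        (\<lambda>h. complex_of_real (2 * l * (v \<bullet> h) / (1 - v \<bullet> v)))) (at v)"
      using disc[OF v] by (auto intro!: derivative_eq_intros simp: field_simps inner_commute)
    then have "((\<lambda>v. complex_of_real (ln ((hnorm H (atom l v))\<^sup>2))) has_derivative
        (\<lambda>h. complex_of_real (2 * l * (v \<bullet> h) / (1 - v \<bullet> v)))) (at v)"
    proof (rule has_derivative_transform_within_open[where s = \<D>])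
      fix u :: complex assume u: "u \<in> \<D>"
      show "complex_of_real (- l * ln (1 - u \<bullet> u)) = complex_of_real (ln ((hnorm H (atom l u))\<^sup>2))"
        using disc[OF u] hnorm_atom[OF u] by (simp add: ln_powr power2_norm_eq_inner)
    qed (use v in auto)
    note D = frechet_derivative_at[OF this, symmetric]
    define q where "q = 1 - v \<bullet> v"
    have "wirtinger_dbar (\<lambda>v. complex_of_real (ln ((hnorm H (atom l v))\<^sup>2))) v
        = (of_real (2 * l * Re v / q) + \<i> * of_real (2 * l * Im v / q)) / 2"
      by (simp add: wirtinger_dbar_def D q_def)
    also have "\<dots> = of_real (l / q) * v"
      by (simp add: complex_eq_iff)
    finally show ?thesis by (simp add: q_def)
  qed
  have "((\<lambda>v. l / (1 - v \<bullet> v)) has_derivative (\<lambda>h. 2 * l * (w \<bullet> h) / (1 - w \<bullet> w)\<^sup>2)) (at w)"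
    using disc[OF w]
    by (auto intro!: derivative_eq_intros simp: field_simps inner_commute power2_eq_square)
  from has_derivative_mult[OF has_derivative_of_real[OF this] has_derivative_ident]
  have "((\<lambda>v. complex_of_real (l / (1 - v \<bullet> v)) * v) has_derivative
      (\<lambda>h. complex_of_real (2 * l * (w \<bullet> h) / (1 - w \<bullet> w)\<^sup>2) * w + complex_of_real (l / (1 - w \<bullet> w)) * h)) (at w)"
    by (simp only: add.commute)
  then have "(wirtinger_dbar (\<lambda>v. complex_of_real (ln ((hnorm H (atom l v))\<^sup>2))) has_derivative
      (\<lambda>h. complex_of_real (2 * l * (w \<bullet> h) / (1 - w \<bullet> w)\<^sup>2) * w + complex_of_real (l / (1 - w \<bullet> w)) * h)) (at w)"
    by (rule has_derivative_transform_within_open[where s = \<D>]) (use w dbar in auto)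
  note D = frechet_derivative_at[OF this, symmetric]
  define q where "q = 1 - w \<bullet> w"
  have q: "q \<noteq> 0" using disc[OF w] by (simp add: q_def)
  have "curvature H (atom l) w = - ((complex_of_real (2 * l * Re w / q\<^sup>2) * w + of_real (l / q)
      - \<i> * (complex_of_real (2 * l * Im w / q\<^sup>2) * w + of_real (l / q) * \<i>)) / 2)"
    by (simp add: curvature_def wirtinger_d_def D q_def)
  also have "\<dots> = - complex_of_real (l * (w \<bullet> w) / q\<^sup>2 + l / q)"
    using q by (simp add: complex_eq_iff inner_complex_def field_simps)
  also have "l * (w \<bullet> w) / q\<^sup>2 + l / q = l / q\<^sup>2"
    using q by (simp add: field_simps power2_eq_square) (simp add: q_def algebra_simps)
  finally show ?thesis by (simp add: q_def power2_norm_eq_inner)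
qed

end

section \<open>Direct sums and frames\<close>

definition single :: "nat \<Rightarrow> (complex \<Rightarrow> complex) \<Rightarrow> (nat \<times> complex \<Rightarrow> complex)" where
  "single i f = (\<lambda>(j, z). if j = i then f z else 0)"

lemma single_apply: "single i f (j, z) = (if j = i then f z else 0)"
  by (simp add: single_def)

definition atom_vector :: "qh_data \<Rightarrow> nat \<Rightarrow> complex \<Rightarrow> (nat \<times> complex \<Rightarrow> complex)" where
  "atom_vector C i w = single i (qh_atom C i w)"

lemma vecs_qh_space:
  "h \<in> vecs (qh_space n C) \<longleftrightarrow>
     (\<forall>i<n. (\<lambda>z. h (i, z)) \<in> vecs (summand C i)) \<and> (\<forall>i\<ge>n. \<forall>z. h (i, z) = 0)"
  by (simp add: qh_space_def direct_sum_def)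

lemma ip_qh_space:
  "ip (qh_space n C) f g = (\<Sum>i<n. ip (summand C i) (\<lambda>z. f (i, z)) (\<lambda>z. g (i, z)))"
  by (simp add: qh_space_def direct_sum_def)

lemma frame_above_diagonal: "j < i \<Longrightarrow> frame n C j w (i, z) = 0"
  by (simp add: frame_def)

context
  fixes n :: nat and C :: qh_data
  assumes Q: "quasi_homogeneous n C"
begin

lemma lam_pos: "0 < lam C i"
  using Q by (auto simp: quasi_homogeneous_def lam_def intro!: add_pos_nonneg)

lemma lam_strict_mono: "i < j \<Longrightarrow> lam C i < lam C j"
  using Q by (simp add: quasi_homogeneous_def lam_def)

lemma summand_bergman: "i < n \<Longrightarrow> bergman_space (lam C i) (summand C i)"
  and mu_diagonal: "i < n \<Longrightarrow> mu C i i = 1"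
  and mu_superdiagonal: "Suc i < n \<Longrightarrow> mu C i (Suc i) \<noteq> 0"
  using Q unfolding quasi_homogeneous_def by blast+

lemma summand_hilbert: "i < n \<Longrightarrow> hilbert (summand C i)"
  by (rule bergman_hilbert[OF summand_bergman])

lemma qh_space_hilbert: "hilbert (qh_space n C)"
  using Q unfolding quasi_homogeneous_def cowen_douglas_def by blast

lemma qh_space_outside:
  assumes "h \<in> vecs (qh_space n C)" "z \<notin> \<D>"
  shows "h (i, z) = 0"
proof (cases "i < n")
  case True
  then show ?thesis
    using bergman_outside[OF summand_bergman, of i "\<lambda>z. h (i, z)" z] assms by (simp add: vecs_qh_space)
qed (use assms in \<open>auto simp: vecs_qh_space\<close>)

lemma qh_atom_in_summand: "i < n \<Longrightarrow> w \<in> \<D> \<Longrightarrow> qh_atom C i w \<in> vecs (summand C i)"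
  unfolding qh_atom_def by (rule atom_in_bergman[OF summand_bergman])

lemma single_in_qh_space:
  assumes "i < n" "f \<in> vecs (summand C i)"
  shows "single i f \<in> vecs (qh_space n C)"
  unfolding vecs_qh_space
proof (intro conjI allI impI)
  fix j assume "j < n"
  have "(\<lambda>z. single i f (j, z)) = (if j = i then f else 0)"
    by (auto simp: single_apply)
  then show "(\<lambda>z. single i f (j, z)) \<in> vecs (summand C j)"
    using assms vecs_zero[OF summand_hilbert[OF \<open>j < n\<close>]] by simp
qed (use assms in \<open>auto simp: single_apply\<close>)

lemma ip_single:
  assumes i: "i < n" and h: "h \<in> vecs (qh_space n C)"
  shows "ip (qh_space n C) h (single i f) = ip (summand C i) (\<lambda>z. h (i, z)) f"
proof -
  have comp: "(\<lambda>z. single i f (j, z)) = (if j = i then f else 0)" for j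
    by (auto simp: single_apply)
  have "ip (qh_space n C) h (single i f)
      = (\<Sum>j<n. if j = i then ip (summand C i) (\<lambda>z. h (i, z)) f else 0)"
    unfolding ip_qh_space
    using h by (intro sum.cong) (auto simp: comp vecs_qh_space ip_zero_right[OF summand_hilbert])
  then show ?thesis using i by simp
qed

lemma hnorm_single:
  assumes "i < n" "f \<in> vecs (summand C i)"
  shows "hnorm (qh_space n C) (single i f) = hnorm (summand C i) f"
  using ip_single[OF assms(1) single_in_qh_space[OF assms], of f]
  by (simp add: hnorm_def single_apply)

lemma atom_vector_in_qh_space: "i < n \<Longrightarrow> w \<in> \<D> \<Longrightarrow> atom_vector C i w \<in> vecs (qh_space n C)"
  unfolding atom_vector_def by (intro single_in_qh_space qh_atom_in_summand)

lemma ip_atom_vector: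
  assumes "i < n" "w \<in> \<D>" "h \<in> vecs (qh_space n C)"
  shows "ip (qh_space n C) h (atom_vector C i w) = h (i, cnj w)"
proof -
  have "(\<lambda>z. h (i, z)) \<in> vecs (summand C i)" using assms by (simp add: vecs_qh_space)
  then show ?thesis
    using ip_atom[OF summand_bergman[OF assms(1)] assms(2)] assms
    by (simp add: atom_vector_def ip_single qh_atom_def)
qed

lemma hnorm_qh_atom:
  "i < n \<Longrightarrow> w \<in> \<D> \<Longrightarrow>
     (hnorm (summand C i) (qh_atom C i w))\<^sup>2 = (1 - (cmod w)\<^sup>2) powr (- lam C i)"
  unfolding qh_atom_def by (rule hnorm_atom[OF summand_bergman])

lemma hnorm_component_le:
  assumes i: "i < n" and h: "h \<in> vecs (qh_space n C)"
  shows "(hnorm (summand C i) (\<lambda>z. h (i, z)))\<^sup>2 \<le> (hnorm (qh_space n C) h)\<^sup>2"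
proof -
  let ?N = "\<lambda>j. Re (ip (summand C j) (\<lambda>z. h (j, z)) (\<lambda>z. h (j, z)))"
  have nonneg: "0 \<le> ?N j" if "j < n" for j
    using Re_ip_self_nonneg[OF summand_hilbert[OF that]] h that by (simp add: vecs_qh_space)
  have "?N i \<le> (\<Sum>j<n. ?N j)"
    using i nonneg by (intro member_le_sum) auto
  then show ?thesis
    using nonneg i sum_nonneg[of "{..<n}" ?N] by (simp add: hnorm_def ip_qh_space)
qed

lemma frame_diagonal: "j < n \<Longrightarrow> frame n C j w (j, z) = qh_atom C j w z"
  using mu_diagonal by (simp add: frame_def)

lemma frame_at_zero:
  assumes "j < n"
  shows "frame n C j w (i, 0) = (if i = j then 1 else 0)"
  using assms mu_diagonal by (auto simp: frame_def qh_atom_def atom_zero)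

lemma frame_in_qh_space:
  assumes j: "j < n" and w: "w \<in> \<D>"
  shows "frame n C j w \<in> vecs (qh_space n C)"
  unfolding vecs_qh_space
proof (intro conjI allI impI)
  fix i assume i: "i < n"
  let ?c = "if i \<le> j then mu C i j else 0"
  have "(\<lambda>z. frame n C j w (i, z)) = cscale ?c (\<lambda>z. (deriv ^^ (j - i)) (\<lambda>v. qh_atom C i v z) w)"
    using j by (auto simp: frame_def cscale_def)
  then show "(\<lambda>z. frame n C j w (i, z)) \<in> vecs (summand C i)"
    using vecs_scale[OF summand_hilbert[OF i]]
      atom_derivative_in_bergman[OF summand_bergman[OF i] lam_pos w]
    by (simp add: qh_atom_def)
qed (use j in \<open>auto simp: frame_def\<close>)

lemma frame_in_curve: "j < n \<Longrightarrow> frame n C j w \<in> curve n C w"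
  unfolding curve_def by (intro cfun.span_base) auto

lemma curve_subset_qh_space:
  assumes "w \<in> \<D>"
  shows "curve n C w \<subseteq> vecs (qh_space n C)"
  unfolding curve_def
  using frame_in_qh_space[OF _ assms] hilbert_subspace[OF qh_space_hilbert]
  by (intro cfun.span_minimal) auto

text \<open>
  At \<open>z = 0\<close> every atom is constant in its parameter, so its derivatives vanish there and \<open>\<gamma>\<^sub>j (w) (i, 0)\<close> is 1 for
  \<open>i = j\<close> and 0 otherwise. Hence the coordinates of a vector of the curve in the frame are the values of its
  components at 0.
\<close>

lemma curve_expansion:
  assumes "f \<in> curve n C w"
  shows "f (i, z) = (\<Sum>j<n. f (j, 0) * frame n C j w (i, z))"
proof -
  let ?S = "{f. \<forall>i z. f (i, z) = (\<Sum>j<n. f (j, 0) * frame n C j w (i, z))}"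
  have "curve n C w \<subseteq> ?S"
    unfolding curve_def
  proof (rule cfun.span_minimal)
    show "(\<lambda>j. frame n C j w) ` {..<n} \<subseteq> ?S"
    proof (clarify, goal_cases)
      case (1 _ k i z)
      have "(\<Sum>j<n. frame n C k w (j, 0) * frame n C j w (i, z))
          = (\<Sum>j<n. if j = k then frame n C k w (i, z) else 0)"
        using 1 by (intro sum.cong) (auto simp: frame_at_zero)
      then show ?case using 1 by simp
    qed
    show "cfun.subspace ?S"
    proof (rule cfun.subspaceI, goal_cases)
      case (2 f g)
      then have "f (i, z) = (\<Sum>j<n. f (j, 0) * frame n C j w (i, z))"
        "g (i, z) = (\<Sum>j<n. g (j, 0) * frame n C j w (i, z))" for i z
        by blast+
      then have "(f + g) (i, z) = (\<Sum>j<n. f (j, 0) * frame n C j w (i, z))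
          + (\<Sum>j<n. g (j, 0) * frame n C j w (i, z))" for i z
        by (metis plus_fun_apply)
      also have "(\<Sum>j<n. f (j, 0) * frame n C j w (i, z)) + (\<Sum>j<n. g (j, 0) * frame n C j w (i, z))
          = (\<Sum>j<n. (f + g) (j, 0) * frame n C j w (i, z))" for i z
        by (simp add: distrib_right sum.distrib)
      finally show ?case by blast
    next
      case (3 c f)
      then have "f (i, z) = (\<Sum>j<n. f (j, 0) * frame n C j w (i, z))" for i z
        by blast
      then have "cscale c f (i, z) = c * (\<Sum>j<n. f (j, 0) * frame n C j w (i, z))" for i z
        unfolding cscale_def by (rule arg_cong)
      also have "c * (\<Sum>j<n. f (j, 0) * frame n C j w (i, z))
          = (\<Sum>j<n. cscale c f (j, 0) * frame n C j w (i, z))" for i z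
        by (simp add: cscale_def mult.assoc sum_distrib_left)
      finally show ?case by blast
    qed simp
  qed
  then show ?thesis using assms by blast
qed

text \<open>
  The frame is upper triangular with the atoms on the diagonal.
\<close>

lemma curve_highest_component:
  assumes f: "f \<in> curve n C w" and m: "m < n" and above: "\<And>j. m < j \<Longrightarrow> f (j, 0) = 0"
  shows "f (m, z) = f (m, 0) * qh_atom C m w z"
proof -
  have "(\<Sum>j<n. f (j, 0) * frame n C j w (m, z)) = (\<Sum>j<n. if j = m then f (m, 0) * qh_atom C m w z else 0)"
  proof (intro sum.cong refl)
    fix j assume "j \<in> {..<n}"
    then show "f (j, 0) * frame n C j w (m, z) = (if j = m then f (m, 0) * qh_atom C m w z else 0)"
      using above[of j] by (cases j m rule: linorder_cases) (auto simp: frame_diagonal frame_above_diagonal)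
  qed
  then show ?thesis using curve_expansion[OF f, of m z] m by simp
qed

end

section \<open>Unitaries between curves are diagonal\<close>

text \<open>
  The components are compared as functions on the disc, so that this makes sense before the summands of the two
  spaces are known to agree.
\<close>

definition scales_component :: "(nat \<times> complex) fspace \<Rightarrow> ((nat \<times> complex \<Rightarrow> complex) \<Rightarrow> (nat \<times> complex \<Rightarrow> complex))
    \<Rightarrow> nat \<Rightarrow> complex \<Rightarrow> bool" where
  "scales_component H U i u \<longleftrightarrow> cmod u = 1 \<and> (\<forall>f\<in>vecs H. \<forall>z. U f (i, z) = u * f (i, z))"

lemma mult_cnj_unit: "cmod u = 1 \<Longrightarrow> u * cnj u = 1"
  using complex_norm_square[of u] by simp

text \<open>
  The inverse unitary is carried along as a parameter, which makes the situation symmetric in the two curves.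
\<close>

locale congruent_curves =
  fixes n :: nat and C C' :: qh_data
    and U V :: "(nat \<times> complex \<Rightarrow> complex) \<Rightarrow> (nat \<times> complex \<Rightarrow> complex)"
  assumes Q: "quasi_homogeneous n C" and Q': "quasi_homogeneous n C'"
    and U: "unitary_between (qh_space n C) (qh_space n C') U"
    and V: "unitary_between (qh_space n C') (qh_space n C) V"
    and VU: "f \<in> vecs (qh_space n C) \<Longrightarrow> V (U f) = f"
    and UV: "g \<in> vecs (qh_space n C') \<Longrightarrow> U (V g) = g"
    and U_curve: "w \<in> \<D> \<Longrightarrow> U ` curve n C w = curve n C' w"
    and V_curve: "w \<in> \<D> \<Longrightarrow> V ` curve n C' w = curve n C w"
begin

abbreviation "H \<equiv> qh_space n C"
abbreviation "H' \<equiv> qh_space n C'"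

lemma swap: "congruent_curves n C' C V U"
  using Q Q' U V VU UV U_curve V_curve by unfold_locales

lemma U_in: "f \<in> vecs H \<Longrightarrow> U f \<in> vecs H'"
  and U_add: "f \<in> vecs H \<Longrightarrow> g \<in> vecs H \<Longrightarrow> U (f + g) = U f + U g"
  and ip_U: "f \<in> vecs H \<Longrightarrow> g \<in> vecs H \<Longrightarrow> ip H' (U f) (U g) = ip H f g"
  using U unfolding unitary_between_def linear_between_def by blast+

lemma V_in: "g \<in> vecs H' \<Longrightarrow> V g \<in> vecs H"
  using V unfolding unitary_between_def linear_between_def by blast

lemma hnorm_U: "f \<in> vecs H \<Longrightarrow> hnorm H' (U f) = hnorm H f"
  by (simp add: hnorm_def ip_U)

lemma ip_U_left: "f \<in> vecs H \<Longrightarrow> g \<in> vecs H' \<Longrightarrow> ip H' (U f) g = ip H f (V g)"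
  using ip_U[of f "V g"] V_in UV by simp

lemma U_apply:
  assumes "f \<in> vecs H" "i < n" "z \<in> \<D>"
  shows "U f (i, z) = ip H f (V (atom_vector C' i (cnj z)))"
proof -
  have z: "cnj z \<in> \<D>" using assms by simp
  show ?thesis
    using ip_atom_vector[OF Q' assms(2) z U_in[OF assms(1)]]
      ip_U_left[OF assms(1) atom_vector_in_qh_space[OF Q' assms(2) z]] by simp
qed

lemma scales_component_inverse:
  assumes "scales_component H U i u"
  shows "scales_component H' V i (cnj u)"
proof -
  have u: "u * cnj u = 1" and act: "\<And>f z. f \<in> vecs H \<Longrightarrow> U f (i, z) = u * f (i, z)"
    using assms by (auto simp: scales_component_def mult_cnj_unit)
  have "V g (i, z) = cnj u * g (i, z)" if "g \<in> vecs H'" for g z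
  proof -
    have "cnj u * g (i, z) = (u * cnj u) * V g (i, z)"
      using act[OF V_in[OF that], of z] UV[OF that] by (simp add: mult_ac)
    then show ?thesis using u by simp
  qed
  then show ?thesis using assms by (simp add: scales_component_def)
qed

text \<open>
  The value of a component at a point is the inner product with an atom, so the action on the atoms determines the
  component of the image of every vector.
\<close>

lemma scales_component_if_atoms:
  assumes k: "k < n" and u: "cmod u = 1"
    and atoms: "\<And>w. w \<in> \<D> \<Longrightarrow> U (atom_vector C k w) = cscale u (atom_vector C' k w)"
  shows "scales_component H U k u"
proof -
  have "U f (k, z) = u * f (k, z)" if f: "f \<in> vecs H" for f z
  proof (cases "z \<in> \<D>")
    case True
    then have z: "cnj z \<in> \<D>" by simp
    have "f (k, z) = ip H f (atom_vector C k (cnj z))"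
      using ip_atom_vector[OF Q k z f] by simp
    also have "\<dots> = ip H' (U f) (cscale u (atom_vector C' k (cnj z)))"
      using ip_U[OF f atom_vector_in_qh_space[OF Q k z]] atoms[OF z] by simp
    also have "\<dots> = cnj u * U f (k, z)"
      using ip_scale_right[OF qh_space_hilbert[OF Q'] U_in[OF f] atom_vector_in_qh_space[OF Q' k z]]
        ip_atom_vector[OF Q' k z U_in[OF f]] by simp
    finally have "u * f (k, z) = (u * cnj u) * U f (k, z)" by (simp add: mult_ac)
    then show ?thesis using mult_cnj_unit[OF u] by simp
  next
    case False
    then show ?thesis using qh_space_outside[OF Q f] qh_space_outside[OF Q' U_in[OF f]] by simp
  qed
  then show ?thesis using u by (simp add: scales_component_def)
qed

text \<open>
  By \<open>U_apply\<close> the values of \<open>U f\<close> in component \<open>i\<close> are inner products of \<open>f\<close> with preimages of atoms of that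
  component. The inverse also acts by scalars on the components below \<open>k\<close>, so these preimages live in the
  components from \<open>k\<close> on and are orthogonal to \<open>f\<close>.
\<close>

lemma U_vanishes_above:
  assumes diag: "\<And>i. i < k \<Longrightarrow> \<exists>u. scales_component H U i u"
    and f: "f \<in> vecs H" and above: "\<And>j z. k \<le> j \<Longrightarrow> f (j, z) = 0" and i: "k \<le> i"
  shows "U f (i, z) = 0"
proof (cases "i < n \<and> z \<in> \<D>")
  case True
  define g where "g = V (atom_vector C' i (cnj z))"
  have A: "atom_vector C' i (cnj z) \<in> vecs H'"
    using True atom_vector_in_qh_space[OF Q'] by simp
  have g: "g \<in> vecs H" unfolding g_def by (rule V_in[OF A])
  have "ip (summand C j) (\<lambda>z. f (j, z)) (\<lambda>z. g (j, z)) = 0" if j: "j < n" for j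
  proof (cases "j < k")
    case True
    then obtain u where "scales_component H U j u" using diag by blast
    then have "V (atom_vector C' i (cnj z)) (j, x) = cnj u * atom_vector C' i (cnj z) (j, x)" for x
      using scales_component_inverse[of j u] A by (simp add: scales_component_def)
    then have "(\<lambda>z. g (j, z)) = 0"
      using True i by (auto simp: g_def atom_vector_def single_apply)
    then show ?thesis
      using ip_zero_right[OF summand_hilbert[OF Q j]] f j by (simp add: vecs_qh_space)
  next
    case False
    then have "(\<lambda>z. f (j, z)) = 0" using above by auto
    then show ?thesis
      using ip_zero_left[OF summand_hilbert[OF Q j]] g j by (simp add: vecs_qh_space)
  qed
  then show ?thesis
    using U_apply[OF f, of i z] True by (simp add: ip_qh_space flip: g_def)
next
  case False
  then show ?thesis
    using qh_space_outside[OF Q' U_in[OF f]] U_in[OF f] by (auto simp: vecs_qh_space not_less)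
qed

text \<open>
  The value is the conjugate of \<open>g (k, w\<^sup>*)\<close> for a fixed vector \<open>g\<close>, the preimage of the \<open>m\<close>-th atom at 0.
\<close>

lemma U_atom_holomorphic:
  assumes k: "k < n" and m: "m < n"
  shows "(\<lambda>w. U (atom_vector C k w) (m, 0)) holomorphic_on \<D>"
proof -
  define g where "g = V (atom_vector C' m 0)"
  have g: "g \<in> vecs H"
    unfolding g_def by (intro V_in atom_vector_in_qh_space[OF Q' m]) simp
  have "(\<lambda>z. g (k, z)) holomorphic_on \<D>"
    using bergman_holomorphic[OF summand_bergman[OF Q k]] g k by (simp add: vecs_qh_space)
  moreover have "cnj ` \<D> = \<D>"
  proof -
    have "z \<in> cnj ` \<D>" if "z \<in> \<D>" for z using that by (intro image_eqI[of _ _ "cnj z"]) auto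
    then show ?thesis by auto
  qed
  ultimately have "(cnj \<circ> (\<lambda>z. g (k, z)) \<circ> cnj) holomorphic_on \<D>"
    using holomorphic_on_compose_cnj_cnj[of "\<lambda>z. g (k, z)" \<D>] by simp
  then show ?thesis
  proof (rule holomorphic_transform)
    fix w :: complex assume w: "w \<in> \<D>"
    note A = atom_vector_in_qh_space[OF Q k w]
    have "U (atom_vector C k w) (m, 0) = ip H (atom_vector C k w) g"
      using U_apply[OF A m, of 0] by (simp add: g_def)
    also have "\<dots> = cnj (ip H g (atom_vector C k w))"
      by (rule ip_commute[OF qh_space_hilbert[OF Q] g A])
    also have "\<dots> = (cnj \<circ> (\<lambda>z. g (k, z)) \<circ> cnj) w"
      using ip_atom_vector[OF Q k w g] by simp
    finally show "(cnj \<circ> (\<lambda>z. g (k, z)) \<circ> cnj) w = U (atom_vector C k w) (m, 0)" ..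
  qed
qed

text \<open>
  The frame vector \<open>\<gamma>\<^sub>k (w)\<close> differs from the \<open>k\<close>-th atom only in the components below \<open>k\<close>.
\<close>

lemma U_frame_upper:
  assumes k: "k < n" and diag: "\<And>i. i < k \<Longrightarrow> \<exists>u. scales_component H U i u" and w: "w \<in> \<D>" and i: "k \<le> i"
  shows "U (frame n C k w) (i, z) = U (atom_vector C k w) (i, z)"
proof -
  let ?f = "frame n C k w - atom_vector C k w"
  note F = frame_in_qh_space[OF Q k w] and A = atom_vector_in_qh_space[OF Q k w]
  have "?f (j, x) = 0" if "k \<le> j" for j x
    using that k by (cases "j = k")
      (auto simp: atom_vector_def single_apply frame_diagonal[OF Q] frame_above_diagonal)
  then have "U ?f (i, z) = 0"
    using U_vanishes_above[OF diag vecs_diff[OF qh_space_hilbert[OF Q] F A] _ i] by blast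
  moreover have "U (frame n C k w) = U ?f + U (atom_vector C k w)"
    using U_add[OF vecs_diff[OF qh_space_hilbert[OF Q] F A] A] by simp
  ultimately show ?thesis by simp
qed

text \<open>
  Let \<open>m\<close> be the highest component in which the image of the \<open>k\<close>-th atom can be nonzero. There the image is
  \<open>a(w)\<close> times the \<open>m\<close>-th atom of the second curve, with \<open>a\<close> holomorphic, and comparing norms gives
  \<open>|a(w)|\<^sup>2 \<le> (1 - |w|\<^sup>2)\<^sup>s\<close> where \<open>s = \<lambda>\<^sub>m' - \<lambda>\<^sub>k\<close>. If \<open>m > k\<close>, then \<open>s > 0\<close> because of
  \<open>\<lambda>\<^sub>k \<le> \<lambda>\<^sub>k'\<close>, so \<open>a\<close> vanishes. Descending, only the component \<open>k\<close> is left, and the kernel identity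
  \<open>(1 - w v\<^sup>*)\<^sup>-\<^sup>\<lambda> = a(w) a(v)\<^sup>* (1 - w v\<^sup>*)\<^sup>-\<^sup>\<lambda>\<^sup>'\<close> at \<open>v = 0\<close> makes \<open>a\<close> a constant of modulus 1.
\<close>

lemma diagonal_step:
  assumes k: "k < n" and diag: "\<And>i. i < k \<Longrightarrow> \<exists>u. scales_component H U i u"
    and le: "lam C k \<le> lam C' k"
  shows "lam C k = lam C' k \<and> (\<exists>u. scales_component H U k u)"
proof -
  define a where "a m w = U (atom_vector C k w) (m, 0)" for m w
  note A = atom_vector_in_qh_space[OF Q k]
  have top: "U (atom_vector C k w) (m, z) = a m w * qh_atom C' m w z"
    if m: "k \<le> m" "m < n" and w: "w \<in> \<D>"
      and above: "\<And>j. m < j \<Longrightarrow> U (atom_vector C k w) (j, 0) = 0" for m w z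
  proof -
    have "U (frame n C k w) \<in> curve n C' w"
      using frame_in_curve[OF Q k, of w] U_curve[OF w] by blast
    then have "U (frame n C k w) (m, z) = U (frame n C k w) (m, 0) * qh_atom C' m w z"
      using m above by (intro curve_highest_component[OF Q']) (auto simp: U_frame_upper[OF k diag w])
    then show ?thesis using U_frame_upper[OF k diag w m(1)] by (simp add: a_def)
  qed
  have norm: "(cmod (a m w))\<^sup>2 * (1 - (cmod w)\<^sup>2) powr (- lam C' m) \<le> (1 - (cmod w)\<^sup>2) powr (- lam C k)"
    if m: "m < n" and w: "w \<in> \<D>"
      and eq: "\<And>z. U (atom_vector C k w) (m, z) = a m w * qh_atom C' m w z" for m w
  proof -
    have "(\<lambda>z. U (atom_vector C k w) (m, z)) = cscale (a m w) (qh_atom C' m w)"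
      using eq by (auto simp: cscale_def)
    then have "(cmod (a m w))\<^sup>2 * (1 - (cmod w)\<^sup>2) powr (- lam C' m)
        = (hnorm (summand C' m) (\<lambda>z. U (atom_vector C k w) (m, z)))\<^sup>2"
      using hnorm_scale[OF summand_hilbert[OF Q' m] qh_atom_in_summand[OF Q' m w]]
        hnorm_qh_atom[OF Q' m w] by (simp add: power_mult_distrib)
    also have "\<dots> \<le> (hnorm H' (U (atom_vector C k w)))\<^sup>2"
      by (rule hnorm_component_le[OF Q' m U_in[OF A[OF w]]])
    also have "\<dots> = (1 - (cmod w)\<^sup>2) powr (- lam C k)"
      using hnorm_U[OF A[OF w]] hnorm_single[OF Q k qh_atom_in_summand[OF Q k w]]
        hnorm_qh_atom[OF Q k w] by (simp add: atom_vector_def)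
    finally show ?thesis .
  qed
  \<comment> \<open>Descending induction on \<open>m\<close>.\<close>
  have higher: "U (atom_vector C k w) (m, z) = 0" if "k < m" "w \<in> \<D>" for m w z
    using that
  proof (induction "n - m" arbitrary: m w z rule: less_induct)
    case less
    show ?case
    proof (cases "m < n")
      case False
      then show ?thesis using U_in[OF A[OF less.prems(2)]] by (simp add: vecs_qh_space)
    next
      case m: True
      have eq: "U (atom_vector C k v) (m, x) = a m v * qh_atom C' m v x" if "v \<in> \<D>" for v x
        using less m that by (intro top) auto
      have "a m w = 0"
      proof (rule holomorphic_eq_zero_if_boundary_decay[where a = "a m" and w = w])
        show "a m holomorphic_on \<D>" using U_atom_holomorphic[OF k m] by (simp add: a_def[abs_def])
        show "0 < lam C' m - lam C k"
          using lam_strict_mono[OF Q' less.prems(1)] le by simp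
        show "(cmod (a m v))\<^sup>2 \<le> (1 - (cmod v)\<^sup>2) powr (lam C' m - lam C k)" if v: "v \<in> \<D>" for v
        proof -
          have "(cmod v)\<^sup>2 < 1" using v by (simp add: abs_square_less_1)
          then show ?thesis using norm[OF m v eq[OF v]]
            by (simp add: powr_diff powr_minus field_simps)
        qed
      qed (rule less.prems)
      then show ?thesis using eq[OF less.prems(2)] by simp
    qed
  qed
  \<comment> \<open>Components below \<open>k\<close> of the image are scalar multiples of those of the atom, which are 0.\<close>
  have lower: "U (atom_vector C k w) (i, z) = 0" if "i < k" "w \<in> \<D>" for i w z
  proof -
    obtain v where "scales_component H U i v" using diag[OF \<open>i < k\<close>] by blast
    then show ?thesis using A[OF \<open>w \<in> \<D>\<close>] \<open>i < k\<close>
      by (simp add: scales_component_def atom_vector_def single_apply)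
  qed
  have U_atom: "U (atom_vector C k w) = cscale (a k w) (atom_vector C' k w)" if w: "w \<in> \<D>" for w
  proof (rule ext)
    fix x :: "nat \<times> complex"
    obtain i z where x: "x = (i, z)" by fastforce
    consider "i < k" | "k < i" | "i = k" by linarith
    then show "U (atom_vector C k w) x = cscale (a k w) (atom_vector C' k w) x"
      using lower[OF _ w] higher[OF _ w] top[OF order_refl k w higher[OF _ w]]
      by cases (auto simp: x cscale_def atom_vector_def single_apply)
  qed
  have polar: "ip H (atom_vector C k w) (atom_vector C k v)
      = a k w * cnj (a k v) * qh_atom C' k w (cnj v)" if w: "w \<in> \<D>" and v: "v \<in> \<D>" for w v
  proof -
    note A' = atom_vector_in_qh_space[OF Q' k]
    have "ip H (atom_vector C k w) (atom_vector C k v)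
        = ip H' (cscale (a k w) (atom_vector C' k w)) (cscale (a k v) (atom_vector C' k v))"
      using ip_U[OF A[OF w] A[OF v]] U_atom w v by simp
    also have "\<dots> = a k w * (cnj (a k v) * ip H' (atom_vector C' k w) (atom_vector C' k v))"
      using w v A' by (simp add: ip_scale_left[OF qh_space_hilbert[OF Q']]
          ip_scale_right[OF qh_space_hilbert[OF Q']] vecs_scale[OF qh_space_hilbert[OF Q']])
    finally show ?thesis
      using ip_atom_vector[OF Q' k v A'[OF w]] by (simp add: atom_vector_def single_apply)
  qed
  define u where "u = a k 0"
  have const: "a k w * cnj u = 1" if w: "w \<in> \<D>" for w
    using polar[OF w, of 0] ip_atom_vector[OF Q k _ A[OF w], of 0]
    by (simp add: u_def atom_vector_def single_apply qh_atom_def atom_zero)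
  have "(cmod u)\<^sup>2 = 1"
    using const[of 0] complex_norm_square[of u] by (simp add: u_def flip: of_real_power)
  then have u: "cmod u = 1" by (simp add: power2_eq_1_iff) (smt (verit) norm_ge_zero)
  have a: "a k w = u" if "w \<in> \<D>" for w
  proof -
    have "cnj u \<noteq> 0" using u by auto
    then show ?thesis using const[OF that] mult_cnj_unit[OF u] by (metis mult_right_cancel)
  qed
  have "scales_component H U k u"
    using scales_component_if_atoms[OF k u] U_atom a by simp
  moreover have "lam C k = lam C' k"
  proof -
    \<comment> \<open>At any point except 0 the norm of an atom determines its weight.\<close>
    define w :: complex where "w = 1 / 2"
    have w: "w \<in> \<D>" "1 - (cmod w)\<^sup>2 = 3 / 4" by (auto simp: w_def norm_divide power2_eq_square)
    have "hnorm H (atom_vector C k w) = hnorm H' (atom_vector C' k w)"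
      using hnorm_U[OF A[OF w(1)]] U_atom[OF w(1)] a[OF w(1)] u
        hnorm_scale[OF qh_space_hilbert[OF Q'] atom_vector_in_qh_space[OF Q' k w(1)]] by simp
    then have "(3 / 4 :: real) powr (- lam C k) = (3 / 4) powr (- lam C' k)"
      using hnorm_single[OF Q k qh_atom_in_summand[OF Q k w(1)]] hnorm_qh_atom[OF Q k w(1)]
        hnorm_single[OF Q' k qh_atom_in_summand[OF Q' k w(1)]] hnorm_qh_atom[OF Q' k w(1)]
      by (simp add: w(2) atom_vector_def)
    then show ?thesis by (simp add: powr_inj[of "3/4"])
  qed
  ultimately show ?thesis by blast
qed

end

text \<open>
  The step needs the weight of the second curve to be the larger one. Otherwise it applies to the inverse.
\<close>

theorem (in congruent_curves) unitary_is_diagonal: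
  assumes "k < n"
  shows "lam C k = lam C' k \<and> (\<exists>u. scales_component H U k u)"
  using assms
proof (induction k rule: less_induct)
  case (less k)
  interpret inv: congruent_curves n C' C V U by (rule swap)
  have diag: "\<exists>u. scales_component H U i u" if "i < k" for i using less that by simp
  show ?case
  proof (cases "lam C k \<le> lam C' k")
    case True
    then show ?thesis using diagonal_step[OF less.prems diag] by blast
  next
    case False
    then have "lam C' k \<le> lam C k" by simp
    moreover have "\<exists>u. scales_component H' V i u" if "i < k" for i
      using diag[OF that] scales_component_inverse by blast
    ultimately have "lam C' k = lam C k \<and> (\<exists>u. scales_component H' V k u)"
      using inv.diagonal_step[OF less.prems] by blast
    then show ?thesis using inv.scales_component_inverse by metis
  qed
qed

section \<open>Invariants\<close>

context congruent_curves
begin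

text \<open>
  The vector \<open>U \<gamma>\<^sub>i\<^sub>+\<^sub>1 (0)\<close> lies on the second curve, and its components at 0 show that it is \<open>v\<close> times the frame
  vector of the second curve with the same index. Comparing the components with index \<open>i\<close> gives the relation,
  because the derivative of the \<open>i\<close>-th atom at \<open>w = 0\<close> is the nonzero function \<open>\<lambda>\<^sub>i z\<close>; it is evaluated at
  \<open>z = 1/2\<close>.
\<close>

lemma superdiagonal:
  assumes i: "Suc i < n" and u: "scales_component H U i u" and v: "scales_component H U (Suc i) v"
  shows "u * mu C i (Suc i) = v * mu C' i (Suc i)"
proof -
  let ?f = "frame n C (Suc i) 0"
  note F = frame_in_qh_space[OF Q i, of 0]
  have D: "deriv (\<lambda>w. qh_atom C' i w (1/2)) 0 = of_real (lam C' i) / 2"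
    unfolding qh_atom_def atom_def
    by (rule DERIV_imp_deriv) (auto intro!: derivative_eq_intros)
  have "U ?f \<in> curve n C' 0"
    using frame_in_curve[OF Q i, of 0] U_curve[of 0] by auto
  from curve_expansion[OF Q' this, of i "1/2"]
  have "U ?f (i, 1/2) = (\<Sum>j<n. U ?f (j, 0) * frame n C' j 0 (i, 1/2))" .
  also have "\<dots> = (\<Sum>j<n. if j = Suc i then v * frame n C' (Suc i) 0 (i, 1/2) else 0)"
  proof (intro sum.cong refl)
    fix j assume j: "j \<in> {..<n}"
    show "U ?f (j, 0) * frame n C' j 0 (i, 1/2) = (if j = Suc i then v * frame n C' (Suc i) 0 (i, 1/2) else 0)"
    proof (cases "j = Suc i")
      case True
      then show ?thesis using v F by (simp add: scales_component_def frame_at_zero[OF Q i])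
    next
      case False
      obtain c where "scales_component H U j c" using unitary_is_diagonal j by blast
      then show ?thesis using False F by (simp add: scales_component_def frame_at_zero[OF Q i])
    qed
  qed
  also have "\<dots> = v * frame n C' (Suc i) 0 (i, 1/2)" using i by simp
  finally have "u * frame n C (Suc i) 0 (i, 1/2) = v * frame n C' (Suc i) 0 (i, 1/2)"
    using u F by (simp add: scales_component_def)
  moreover have "qh_atom C i = qh_atom C' i"
    using unitary_is_diagonal[of i] i by (simp add: qh_atom_def)
  ultimately show ?thesis
    using i D lam_pos[OF Q', of i] by (simp add: frame_def)
qed

lemma curvature_eq:
  assumes "i < n" "w \<in> \<D>"
  shows "qh_curvature C i w = qh_curvature C' i w"
  using curvature_atom[OF summand_bergman[OF Q assms(1)] assms(2)]
    curvature_atom[OF summand_bergman[OF Q' assms(1)] assms(2)] unitary_is_diagonal[OF assms(1)]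
  by (simp add: qh_curvature_def qh_atom_def[abs_def])

lemma cmod_mu_eq:
  assumes "Suc i < n"
  shows "cmod (mu C i (Suc i)) = cmod (mu C' i (Suc i))"
proof -
  obtain u v where u: "scales_component H U i u" and v: "scales_component H U (Suc i) v"
    using unitary_is_diagonal[OF assms] unitary_is_diagonal[of i] assms by auto
  have "cmod (u * mu C i (Suc i)) = cmod (v * mu C' i (Suc i))"
    using superdiagonal[OF assms u v] by simp
  then show ?thesis using u v by (simp add: norm_mult scales_component_def)
qed

text \<open>
  Curvatures, norms of atoms and moduli of the constants agree, so the two forms differ only by the factors
  \<open>\<mu>\<^sub>i\<^sub>,\<^sub>i\<^sub>+\<^sub>1\<close> in their numerators.
\<close>

lemma second_fundamental_form_ratio:
  assumes i: "Suc i < n" and w: "w \<in> \<D>"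
  shows "mu C' i (Suc i) * second_fundamental_form C i w = mu C i (Suc i) * second_fundamental_form C' i w"
  using curvature_eq[of i w] cmod_mu_eq[OF i] i w unitary_is_diagonal[of i] unitary_is_diagonal[OF i]
  by (simp add: second_fundamental_form_def hnorm_qh_atom[OF Q] hnorm_qh_atom[OF Q'])

lemma second_fundamental_form_nonzero:
  assumes i: "Suc i < n"
  shows "second_fundamental_form C i 0 \<noteq> 0"
proof -
  have K: "qh_curvature C i 0 = - of_real (lam C i)"
    using curvature_atom[OF summand_bergman[OF Q], of i 0] i
    by (simp add: qh_curvature_def qh_atom_def[abs_def])
  have "0 < 1 + (cmod (mu C i (Suc i)))\<^sup>2 * lam C i"
    using lam_pos[OF Q, of i] by (simp add: add_pos_nonneg)
  moreover have "complex_of_real 1 - complex_of_real ((cmod (mu C i (Suc i)))\<^sup>2) * qh_curvature C i 0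
      = of_real (1 + (cmod (mu C i (Suc i)))\<^sup>2 * lam C i)"
    by (simp add: K)
  ultimately show ?thesis
    using hnorm_qh_atom[OF Q, of i 0] hnorm_qh_atom[OF Q i, of 0] i K mu_superdiagonal[OF Q i] lam_pos[OF Q, of i]
    by (simp add: second_fundamental_form_def flip: of_real_add of_real_mult of_real_power)
qed

text \<open>
  Equal second fundamental forms give equal superdiagonal constants. By \<open>superdiagonal\<close> the scalars by which
  \<open>U\<close> acts on neighbouring components are then equal, so \<open>U\<close> is a single scalar and preserves every subspace.
\<close>

lemma curve_eq:
  assumes theta: "\<And>i. Suc i < n \<Longrightarrow> second_fundamental_form C i 0 = second_fundamental_form C' i 0"
    and w: "w \<in> \<D>"
  shows "curve n C w = curve n C' w"
proof -
  have mu: "mu C i (Suc i) = mu C' i (Suc i)" if "Suc i < n" for i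
    using second_fundamental_form_ratio[OF that, of 0] second_fundamental_form_nonzero[OF that]
      theta[OF that] by simp
  have "0 < n" using Q by (simp add: quasi_homogeneous_def)
  then obtain u where u: "scales_component H U 0 u" using unitary_is_diagonal by blast
  have all: "scales_component H U i u" if "i < n" for i
    using that
  proof (induction i)
    case (Suc i)
    obtain v where v: "scales_component H U (Suc i) v" using unitary_is_diagonal Suc.prems by blast
    have "u * mu C i (Suc i) = v * mu C i (Suc i)"
      using superdiagonal[OF Suc.prems _ v] Suc mu by simp
    then show ?case using v mu_superdiagonal[OF Q Suc.prems] by simp
  qed (rule u)
  have U_eq: "U f = cscale u f" if f: "f \<in> vecs H" for f
  proof (rule ext)
    fix x :: "nat \<times> complex"
    obtain i z where x: "x = (i, z)" by fastforce
    show "U f x = cscale u f x"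
      using all[of i] f U_in[OF f] by (cases "i < n") (auto simp: x scales_component_def cscale_def vecs_qh_space)
  qed
  have sub: "cfun.subspace (curve n C w)" unfolding curve_def by (rule cfun.subspace_span)
  have "cscale u ` curve n C w = curve n C w"
  proof
    show "cscale u ` curve n C w \<subseteq> curve n C w"
      using sub by (auto intro: cfun.subspace_scale)
    show "curve n C w \<subseteq> cscale u ` curve n C w"
    proof
      fix f assume f: "f \<in> curve n C w"
      have "f = cscale u (cscale (cnj u) f)"
        using mult_cnj_unit[of u] u by (simp add: scales_component_def cscale_def flip: mult.assoc)
      then show "f \<in> cscale u ` curve n C w"
        using cfun.subspace_scale[OF sub f, of "cnj u"] by blast
    qed
  qed
  moreover have "cscale u ` curve n C w = U ` curve n C w"
    using curve_subset_qh_space[OF Q w] U_eq by (intro image_cong) auto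
  ultimately show ?thesis using U_curve[OF w] by simp
qed

end

lemma congruent_curves_if_unitarily_equivalent:
  assumes Q: "quasi_homogeneous n C" and Q': "quasi_homogeneous n C'"
    and "unitarily_equivalent n C C'"
  obtains U V where "congruent_curves n C C' U V"
proof -
  obtain U where U: "unitary_between (qh_space n C) (qh_space n C') U"
    and curve: "\<And>w. w \<in> \<D> \<Longrightarrow> U ` curve n C w = curve n C' w"
    using assms(3) unfolding unitarily_equivalent_def by blast
  obtain V where V: "unitary_between (qh_space n C') (qh_space n C) V"
    and VU: "\<And>f. f \<in> vecs (qh_space n C) \<Longrightarrow> V (U f) = f"
    and UV: "\<And>g. g \<in> vecs (qh_space n C') \<Longrightarrow> U (V g) = g"
    using unitary_inverse[OF qh_space_hilbert[OF Q] U] by blast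
  have "V ` curve n C' w = curve n C w" if w: "w \<in> \<D>" for w
  proof -
    have "V ` curve n C' w = (\<lambda>f. V (U f)) ` curve n C w"
      by (simp add: image_image flip: curve[OF w])
    also have "\<dots> = id ` curve n C w"
      using curve_subset_qh_space[OF Q w] VU by (intro image_cong) auto
    finally show ?thesis by simp
  qed
  with Q Q' U V VU UV curve have "congruent_curves n C C' U V"
    by unfold_locales
  then show ?thesis by (rule that)
qed

theorem theorem2p10:
  fixes n :: nat and C C' :: qh_data
  assumes "quasi_homogeneous n C" and "quasi_homogeneous n C'"
  shows
    "(unitarily_equivalent n C C' \<longrightarrow>
        (\<forall>i<n. \<forall>w\<in>\<D>. qh_curvature C i w = qh_curvature C' i w) \<and>
        (\<forall>i. Suc i < n \<longrightarrow>
           (\<exists>c. cmod c = 1 \<and>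
              (\<forall>w\<in>\<D>. second_fundamental_form C i w = c * second_fundamental_form C' i w)))) \<and>
     (unitarily_equivalent n C C' \<and>
        (\<forall>i. Suc i < n \<longrightarrow>
           (\<forall>w\<in>\<D>. second_fundamental_form C i w = second_fundamental_form C' i w)) \<longrightarrow>
        (\<forall>w\<in>\<D>. curve n C w = curve n C' w))"
proof (cases "unitarily_equivalent n C C'")
  case True
  then obtain U V where "congruent_curves n C C' U V"
    using congruent_curves_if_unitarily_equivalent[OF assms] by blast
  then interpret congruent_curves n C C' U V .
  have "\<exists>c. cmod c = 1 \<and> (\<forall>w\<in>\<D>. second_fundamental_form C i w = c * second_fundamental_form C' i w)"
    if i: "Suc i < n" for i
  proof (intro exI conjI ballI)
    let ?c = "mu C i (Suc i) / mu C' i (Suc i)"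
    have nz: "mu C' i (Suc i) \<noteq> 0" by (rule mu_superdiagonal[OF assms(2) i])
    then show "cmod ?c = 1" using cmod_mu_eq[OF i] by (simp add: norm_divide)
    show "second_fundamental_form C i w = ?c * second_fundamental_form C' i w" if "w \<in> \<D>" for w
      using second_fundamental_form_ratio[OF i that] nz by (simp add: field_simps)
  qed
  then show ?thesis using curvature_eq curve_eq by auto
qed simp

end
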